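(* Let $(J,\xi)$ be a Markov additive process on $E\times\mathbb{R}$ ($E$ finite, $J$ irreducible and ergodic) and suppose that, under the equivalent martingale (pricing) measure $\mathbb{P}$, the price process of the asset underlying an Asian call option is $\{Y_t:=\exp(\xi_t):t\ge0\}$. For a strike $k$ put $H(x)=(x-k)^+$, and for $(\alpha,y)\in E\times(0,\infty)$ and maturity $T>0$ let the prices of the European and Asian call options be $$C_H(\alpha,y,T)=e^{-rT}\,\mathbb{E}_{\alpha,\log y}\big[H(Y_T)\big],\qquad C^A_H(\alpha,y,T)=e^{-rT}\,\mathbb{E}_{\alpha,\log y}\Big[H\Big(\int_0^Te^{\xi_s}\,ds\Big)\Big].$$ Let $A^{(\alpha)}:=(Af)(\alpha,1)$, where $A$ is the extended generator of $(J,Y)$ and $f(\alpha,x)=x$. Then the following relations hold: (i) if $A^{(\alpha)}>0$ for all $\alpha\in E$, then the Asian call option, $C^A_H$, is cheaper than the corresponding European call option, $C_H$, for any strike $k$; (ii) if $A^{(\alpha)}<0$ for all $\alpha\in E$, then there exists a $K>0$ such that the European call option, $C_H$, is cheaper than the Asian call option, $C^A_H$, for all strikes $k\le K$.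
   Context: Let $E$ be a finite set. A process $(J_t,\xi_t)_{t\ge0}$ in $E\times\mathbb{R}$ adapted to $(\mathcal{F}_t)$ is a Markov additive process (MAP) if for all bounded continuous $f:E\times\mathbb{R}\to\mathbb{R}^+$ and $s,t>0$, $\mathbb{E}[f(J_{t+s},\xi_{t+s}-\xi_t)\mid\mathcal{F}_t]=\mathbb{E}_{J_t,0}[f(J_s,\xi_s)]$, where $\mathbb{E}_{\alpha,x}$ is expectation given $(J_0,\xi_0)=(\alpha,x)$. $J$ is a continuous-time Markov chain with rates $q_{\alpha,\beta}$ ($\alpha\neq\beta$); while $J$ is in state $\alpha$, $\xi$ evolves as an independent copy of a Lévy process $\xi^{(\alpha)}$; when $J$ jumps from $\alpha$ to $\beta$, $\xi$ makes an additional independent jump distributed as $U_{\alpha,\beta}$. Explicitly, $A^{(\alpha)}=\psi_\alpha(1)+\sum_{\beta\ne\alpha}q_{\alpha,\beta}\big(\mathbb{E}[e^{U_{\alpha,\beta}}]-1\big)$ with $\psi_\alpha(1)=\log\mathbb{E}[e^{\xi^{(\alpha)}_1}]$. $r$ is the constant risk-free interest rate.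
   Formalization: As stated the claim fails (E one point, ξ_t=ξ_0+0.01t, k=0, T=2). Proved for the Asian payoff on the average (1/T)∫_0^T e^{ξ_s}ds for all T>0, and on the integral itself for T≤1 in (i), T≥1 in (ii); "cheaper" in (i) means strictly, unless both prices are 0. *)

theory Defs
  imports "HOL-Probability.Probability"
begin

text \<open>
  Time is the half line \<open>[0,\<infinity>)\<close> inside \<^typ>\<open>real\<close>; values at negative indices are never used.
  A Markov family lives on one measurable space \<open>(\<Omega>, P \<alpha> x)\<close>, where \<open>P \<alpha> x\<close> is the law given
  \<open>(J 0, \<xi> 0) = (\<alpha>, x)\<close>. The measure \<open>F t\<close> only serves as a carrier of the sigma-algebra at
  time \<open>t\<close>.
\<close>

definition martingale_wrt :: "'a measure \<Rightarrow> (real \<Rightarrow> 'a measure) \<Rightarrow> (real \<Rightarrow> 'a \<Rightarrow> real) \<Rightarrow> bool" where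
  "martingale_wrt M F X \<longleftrightarrow>
     (\<forall>t\<ge>0. X t \<in> borel_measurable (F t) \<and> integrable M (X t)) \<and>
     (\<forall>s t. 0 \<le> s \<longrightarrow> s \<le> t \<longrightarrow> (AE \<omega> in M. real_cond_exp M (F s) (X t) \<omega> = X s \<omega>))"

text \<open>
  The type \<open>'e\<close> is the finite set E with its discrete topology, so continuity on
  E \<open>\<times>\<close> \<open>\<real>\<close> is continuity in the second argument. All paths are right-continuous with left limits;
  for \<open>J\<close> this means that they are locally constant to the right and have constant left germs.
\<close>

locale markov_additive_process =
  fixes \<Omega> :: "'a set"
    and F :: "real \<Rightarrow> 'a measure"
    and P :: "'e::finite \<Rightarrow> real \<Rightarrow> 'a measure"
    and J :: "real \<Rightarrow> 'a \<Rightarrow> 'e"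
    and \<xi> :: "real \<Rightarrow> 'a \<Rightarrow> real"
  assumes prob_space: "\<And>\<alpha> x. prob_space (P \<alpha> x)"
    and space_P: "\<And>\<alpha> x. space (P \<alpha> x) = \<Omega>"
    and sets_P: "\<And>\<alpha> x \<beta> z. sets (P \<alpha> x) = sets (P \<beta> z)"
    and subalgebra_F: "\<And>\<alpha> x t. 0 \<le> t \<Longrightarrow> subalgebra (P \<alpha> x) (F t)"
    and F_mono: "\<And>s t. 0 \<le> s \<Longrightarrow> s \<le> t \<Longrightarrow> sets (F s) \<subseteq> sets (F t)"
    and adapted_J: "\<And>t. 0 \<le> t \<Longrightarrow> J t \<in> measurable (F t) (count_space UNIV)"
    and adapted_xi: "\<And>t. 0 \<le> t \<Longrightarrow> \<xi> t \<in> borel_measurable (F t)"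
    and J_right: "\<And>\<omega> t. \<omega> \<in> \<Omega> \<Longrightarrow> 0 \<le> t \<Longrightarrow> \<forall>\<^sub>F s in at_right t. J s \<omega> = J t \<omega>"
    and J_left: "\<And>\<omega> t. \<omega> \<in> \<Omega> \<Longrightarrow> 0 < t \<Longrightarrow> \<exists>\<beta>. \<forall>\<^sub>F s in at_left t. J s \<omega> = \<beta>"
    and xi_right: "\<And>\<omega> t. \<omega> \<in> \<Omega> \<Longrightarrow> 0 \<le> t \<Longrightarrow> ((\<lambda>s. \<xi> s \<omega>) \<longlongrightarrow> \<xi> t \<omega>) (at_right t)"
    and xi_left: "\<And>\<omega> t. \<omega> \<in> \<Omega> \<Longrightarrow> 0 < t \<Longrightarrow> \<exists>l. ((\<lambda>s. \<xi> s \<omega>) \<longlongrightarrow> l) (at_left t)"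
    and start: "\<And>\<alpha> x. AE \<omega> in P \<alpha> x. J 0 \<omega> = \<alpha> \<and> \<xi> 0 \<omega> = x"
    and markov_additive:
      "\<And>\<alpha> x s t f. 0 < s \<Longrightarrow> 0 < t \<Longrightarrow>
         (\<And>\<beta>. continuous_on UNIV (f \<beta>)) \<Longrightarrow> (\<And>\<beta> z. 0 \<le> f \<beta> z) \<Longrightarrow> (\<exists>B. \<forall>\<beta> z. f \<beta> z \<le> B) \<Longrightarrow>
         AE \<omega> in P \<alpha> x.
           real_cond_exp (P \<alpha> x) (F t) (\<lambda>\<omega>'. f (J (t + s) \<omega>') (\<xi> (t + s) \<omega>' - \<xi> t \<omega>')) \<omega>
             = (\<integral>\<omega>'. f (J s \<omega>') (\<xi> s \<omega>') \<partial>(P (J t \<omega>) 0))"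

text \<open>The law of \<open>J\<close> under \<open>P \<alpha> x\<close> does not depend on \<open>x\<close>; we take \<open>x = 0\<close>.\<close>

definition irreducible_modulator ::
    "('e \<Rightarrow> real \<Rightarrow> 'a measure) \<Rightarrow> (real \<Rightarrow> 'a \<Rightarrow> 'e) \<Rightarrow> bool" where
  "irreducible_modulator P J \<longleftrightarrow>
     (\<forall>\<alpha> \<beta>. \<exists>t>0. 0 < measure (P \<alpha> 0) {\<omega> \<in> space (P \<alpha> 0). J t \<omega> = \<beta>})"

definition ergodic_modulator ::
    "('e::finite \<Rightarrow> real \<Rightarrow> 'a measure) \<Rightarrow> (real \<Rightarrow> 'a \<Rightarrow> 'e) \<Rightarrow> bool" where
  "ergodic_modulator P J \<longleftrightarrow>
     (\<exists>\<pi>::'e \<Rightarrow> real. (\<forall>\<beta>. 0 < \<pi> \<beta>) \<and> (\<Sum>\<beta>\<in>UNIV. \<pi> \<beta>) = 1 \<and>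
        (\<forall>\<alpha> \<beta>. ((\<lambda>t. measure (P \<alpha> 0) {\<omega> \<in> space (P \<alpha> 0). J t \<omega> = \<beta>}) \<longlongrightarrow> \<pi> \<beta>) at_top))"

text \<open>
  \<open>f\<close> is in the domain of the extended generator of the Markov family \<open>(X, Q)\<close> with state space
  \<open>S\<close>, and \<open>g\<close> is a version of its image, if Dynkin's process
  \<open>f (X t) - f (X 0) - \<integral>\<^sub>0\<^sup>t g (X s) ds\<close> is a well-defined martingale from every starting point.
  The image is thus determined only up to sets of potential zero.
\<close>

definition extended_generator ::
    "'s measure \<Rightarrow> ('s \<Rightarrow> 'a measure) \<Rightarrow> (real \<Rightarrow> 'a measure) \<Rightarrow> (real \<Rightarrow> 'a \<Rightarrow> 's) \<Rightarrow>
     ('s \<Rightarrow> real) \<Rightarrow> ('s \<Rightarrow> real) \<Rightarrow> bool" where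
  "extended_generator S Q F X f g \<longleftrightarrow>
     f \<in> borel_measurable S \<and> g \<in> borel_measurable S \<and>
     (\<forall>x\<in>space S.
        (\<forall>t\<ge>0. (\<integral>\<^sup>+\<omega>. (\<integral>\<^sup>+s\<in>{0..t}. ennreal \<bar>g (X s \<omega>)\<bar> \<partial>lborel) \<partial>(Q x)) < \<infinity>) \<and>
        martingale_wrt (Q x) F
          (\<lambda>t \<omega>. f (X t \<omega>) - f (X 0 \<omega>) - (LINT s:{0..t}|lborel. g (X s \<omega>))))"

text \<open>
  A version of the extended generator of \<open>(J, exp \<xi>)\<close> at \<open>(\<alpha>, y) \<mapsto> y\<close>, on the state space
  E \<open>\<times>\<close> \<open>(0,\<infinity>)\<close>. Continuity of \<open>g\<close> in \<open>y\<close> selects the one version that has a meaningful value at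
  each single point; without it the values \<open>g (\<alpha>, 1)\<close> could be altered at will.
\<close>

definition price_generator ::
    "(real \<Rightarrow> 'a measure) \<Rightarrow> ('e \<Rightarrow> real \<Rightarrow> 'a measure) \<Rightarrow> (real \<Rightarrow> 'a \<Rightarrow> 'e) \<Rightarrow>
     (real \<Rightarrow> 'a \<Rightarrow> real) \<Rightarrow> ('e \<times> real \<Rightarrow> real) \<Rightarrow> bool" where
  "price_generator F P J \<xi> g \<longleftrightarrow>
     extended_generator
       (count_space UNIV \<Otimes>\<^sub>M restrict_space borel {0<..})
       (\<lambda>(\<alpha>, y). P \<alpha> (ln y)) F (\<lambda>t \<omega>. (J t \<omega>, exp (\<xi> t \<omega>)))
       (\<lambda>(\<alpha>, y). y) g \<and>
     (\<forall>\<alpha>. continuous_on {0<..} (\<lambda>y. g (\<alpha>, y)))"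

definition call_payoff :: "real \<Rightarrow> real \<Rightarrow> real" where
  "call_payoff k x = max (x - k) 0"

definition european_call ::
    "('e \<Rightarrow> real \<Rightarrow> 'a measure) \<Rightarrow> (real \<Rightarrow> 'a \<Rightarrow> real) \<Rightarrow> real \<Rightarrow> real \<Rightarrow> 'e \<Rightarrow> real \<Rightarrow> real \<Rightarrow> real" where
  "european_call P \<xi> r k \<alpha> y T =
     exp (- r * T) * (\<integral>\<omega>. call_payoff k (exp (\<xi> T \<omega>)) \<partial>(P \<alpha> (ln y)))"

text \<open>The Asian call written on the time integral of the price.\<close>

definition asian_call ::
    "('e \<Rightarrow> real \<Rightarrow> 'a measure) \<Rightarrow> (real \<Rightarrow> 'a \<Rightarrow> real) \<Rightarrow> real \<Rightarrow> real \<Rightarrow> 'e \<Rightarrow> real \<Rightarrow> real \<Rightarrow> real" where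
  "asian_call P \<xi> r k \<alpha> y T =
     exp (- r * T) *
       (\<integral>\<omega>. call_payoff k (LINT s:{0..T}|lborel. exp (\<xi> s \<omega>)) \<partial>(P \<alpha> (ln y)))"

text \<open>The Asian call written on the time average of the price.\<close>

definition asian_average_call ::
    "('e \<Rightarrow> real \<Rightarrow> 'a measure) \<Rightarrow> (real \<Rightarrow> 'a \<Rightarrow> real) \<Rightarrow> real \<Rightarrow> real \<Rightarrow> 'e \<Rightarrow> real \<Rightarrow> real \<Rightarrow> real" where
  "asian_average_call P \<xi> r k \<alpha> y T =
     exp (- r * T) *
       (\<integral>\<omega>. call_payoff k ((1 / T) * (LINT s:{0..T}|lborel. exp (\<xi> s \<omega>))) \<partial>(P \<alpha> (ln y)))"

text \<open>
  Strictly cheaper, unless both options are worthless: for large strikes and bounded prices both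
  option prices are zero, so a strict inequality cannot hold for every strike.
\<close>

definition cheaper :: "real \<Rightarrow> real \<Rightarrow> bool" where
  "cheaper c d \<longleftrightarrow> c < d \<or> (c = 0 \<and> d = 0)"

end

theory Submission
  imports Defs
begin

text \<open>
Write \<open>Y = exp \<xi>\<close>. The comparison of the two options rests on the sign of the drift of \<open>Y\<close>, so the
work lies in reading that drift off the generator.

\<^emph>\<open>The drift.\<close> Dynkin's martingale gives \<open>E Y t = y + E (\<integral> Af (J s, Y s) ds)\<close> from every starting
point. The signs are given at \<open>y = 1\<close> only, so one has to show \<open>Af (\<beta>, y) = y * Af (\<beta>, 1)\<close>
(\<open>price_generator_homogeneous\<close>). The increments of \<open>\<xi>\<close> do not depend on its position, hence
\<open>(\<beta>, y) \<mapsto> Af (\<beta>, c * y) / c\<close> is another version of the generator, and the difference \<open>h\<close> of the two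
has zero potential: \<open>E (\<integral> h (J s, Y s) ds) = 0\<close> over every interval \<open>[0, T]\<close> and from every starting
point. Such an \<open>h\<close> vanishes if it is continuous in \<open>y\<close> (\<open>potential_zero\<close>). By the Markov property
\<open>\<integral> v (J (t i), Y (t i)) * h (J u, Y u) du\<close> has mean zero over each cell \<open>[t i, t (i + 1))\<close> of a grid,
for every bounded \<open>v\<close>; when the mesh tends to zero, \<open>v\<close> at the left end of the cell tends to \<open>v\<close> at
time \<open>u\<close>, except for the countably many jump times of the path, so that
\<open>E (\<integral> v (J u, Y u) * h (J u, Y u) du) = 0\<close>. The choice \<open>v = min 1 (max 0 h)\<close> shows that \<open>h \<le> 0\<close> along
the path, and right continuity at time \<open>0\<close> transfers this to the starting point.

\<^emph>\<open>The options.\<close> If all \<open>Af (\<beta>, 1)\<close> are positive, the mean of \<open>Y\<close> increases strictly from every starting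
point. Conditioning at \<open>s < T\<close> and Jensen's inequality give \<open>E H (Y s) \<le> E H (Y T)\<close>, with equality only
if both sides are zero, since equality forces the conditional mean of \<open>Y T\<close> below the strike
(\<open>expected_payoff_increasing\<close>). Jensen's inequality in time bounds the payoff on the average price by
the time average of \<open>H (Y s)\<close>. If all \<open>Af (\<beta>, 1)\<close> are negative, the mean of \<open>Y\<close> decreases strictly, so
the mean of the average price exceeds \<open>E Y T\<close>; this is the strict inequality at the strike \<open>0\<close>. For
negative strikes both payoffs are linear, and for small positive strikes the gap at \<open>0\<close> absorbs the
strike, because payoffs are nonincreasing and 1-Lipschitz in it.
\<close>

section \<open>One-sided limits and grids on the half line\<close>

lemma LIMSEQ_from_right_grid:
  assumes "0 \<le> t" and "(f \<longlongrightarrow> l) (at_right (t::real))"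
  shows "(\<lambda>n. f (real_of_int (\<lfloor>real (Suc n) * t\<rfloor> + 1) / real (Suc n))) \<longlonglongrightarrow> l"
proof (rule filterlim_compose[OF assms(2)])
  have gt: "t < real_of_int (\<lfloor>real (Suc n) * t\<rfloor> + 1) / real (Suc n)" for n
    by (simp add: field_simps del: of_nat_Suc) linarith
  have le: "real_of_int (\<lfloor>real (Suc n) * t\<rfloor> + 1) / real (Suc n) \<le> t + 1 / real (Suc n)" for n
  proof -
    have "real_of_int (\<lfloor>real (Suc n) * t\<rfloor> + 1) \<le> real (Suc n) * t + 1" by linarith
    then have "real_of_int (\<lfloor>real (Suc n) * t\<rfloor> + 1) / real (Suc n) \<le> (real (Suc n) * t + 1) / real (Suc n)"
      by (rule divide_right_mono) simp
    also have "\<dots> = t + 1 / real (Suc n)" by (simp add: field_simps del: of_nat_Suc)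
    finally show ?thesis .
  qed
  have lim: "(\<lambda>n. t + 1 / real (Suc n)) \<longlonglongrightarrow> t"
    using tendsto_add[OF tendsto_const LIMSEQ_inverse_real_of_nat, of t]
    by (simp add: inverse_eq_divide)
  have "(\<lambda>n. real_of_int (\<lfloor>real (Suc n) * t\<rfloor> + 1) / real (Suc n)) \<longlonglongrightarrow> t"
    by (rule tendsto_sandwich[OF _ _ tendsto_const lim])
      (intro always_eventually allI less_imp_le[OF gt] le)+
  then show "filterlim (\<lambda>n. real_of_int (\<lfloor>real (Suc n) * t\<rfloor> + 1) / real (Suc n)) (at_right t) sequentially"
    using gt by (intro tendsto_imp_filterlim_at_right) auto
qed

text \<open>
Approximating from the right by the next point of a grid replaces the time by a countably valued
function of time; right continuity makes these approximations converge at every point.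
\<close>

lemma jointly_measurable_right_continuous:
  fixes X :: "real \<Rightarrow> 'b \<Rightarrow> real"
  assumes meas: "\<And>t. 0 \<le> t \<Longrightarrow> X t \<in> borel_measurable M"
    and right: "\<And>\<omega> t. \<omega> \<in> space M \<Longrightarrow> 0 \<le> t \<Longrightarrow> ((\<lambda>s. X s \<omega>) \<longlongrightarrow> X t \<omega>) (at_right t)"
  shows "(\<lambda>(t, \<omega>). X (max 0 t) \<omega>) \<in> borel_measurable (borel \<Otimes>\<^sub>M M)"
proof (rule borel_measurable_LIMSEQ_real)
  let ?g = "\<lambda>n t. \<lfloor>real (Suc n) * max 0 t\<rfloor>"
  let ?s = "\<lambda>n k. real_of_int (max 0 k + 1) / real (Suc n)"
  fix n
  have s: "X (?s n k) \<in> borel_measurable M" for k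
    by (rule meas) auto
  show "(\<lambda>p. X (?s n (?g n (fst p))) (snd p)) \<in> borel_measurable (borel \<Otimes>\<^sub>M M)"
  proof (rule measurable_compose_countable[where g="\<lambda>p. ?g n (fst p)"
        and f="\<lambda>k p. X (?s n k) (snd p)"])
    show "(\<lambda>p. X (?s n i) (snd p)) \<in> borel_measurable (borel \<Otimes>\<^sub>M M)" for i
      using measurable_compose[OF measurable_snd s] by simp
    show "(\<lambda>p. ?g n (fst p)) \<in> borel \<Otimes>\<^sub>M M \<rightarrow>\<^sub>M count_space UNIV"
      by measurable
  qed
next
  fix p :: "real \<times> 'b" assume "p \<in> space (borel \<Otimes>\<^sub>M M)"
  then obtain t \<omega> where p: "p = (t, \<omega>)" "\<omega> \<in> space M"
    by (auto simp: space_pair_measure)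
  show "(\<lambda>n. X (real_of_int (max 0 \<lfloor>real (Suc n) * max 0 (fst p)\<rfloor> + 1) / real (Suc n)) (snd p))
      \<longlonglongrightarrow> (case p of (t, \<omega>) \<Rightarrow> X (max 0 t) \<omega>)"
  proof -
    have "max 0 \<lfloor>real (Suc n) * max 0 t\<rfloor> = \<lfloor>real (Suc n) * max 0 t\<rfloor>" for n
      by (simp add: zero_le_mult_iff)
    then show ?thesis
      using LIMSEQ_from_right_grid[OF _ right[OF p(2)], of "max 0 t"] by (simp add: p(1))
  qed
qed

lemma emeasure_distr_density_indicator:
  assumes [measurable]: "S \<in> sets M" "X \<in> measurable M N" "B \<in> sets N"
  shows "emeasure (distr (density M (\<lambda>\<omega>. c * indicator S \<omega>)) N X) B
    = c * emeasure M (S \<inter> (X -` B \<inter> space M))"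
proof -
  have "emeasure (distr (density M (\<lambda>\<omega>. c * indicator S \<omega>)) N X) B
      = (\<integral>\<^sup>+\<omega>. c * indicator S \<omega> * indicator (X -` B \<inter> space M) \<omega> \<partial>M)"
    by (simp add: emeasure_distr emeasure_density)
  also have "\<dots> = (\<integral>\<^sup>+\<omega>. c * indicator (S \<inter> (X -` B \<inter> space M)) \<omega> \<partial>M)"
    by (intro nn_integral_cong) (auto simp: indicator_def)
  also have "\<dots> = c * emeasure M (S \<inter> (X -` B \<inter> space M))"
    by (simp add: nn_integral_cmult_indicator)
  finally show ?thesis .
qed

lemma nn_integral_distr_density_indicator:
  assumes [measurable]: "S \<in> sets M" "X \<in> measurable M N" "f \<in> borel_measurable N"
  shows "(\<integral>\<^sup>+y. f y \<partial>distr (density M (indicator S)) N X) = (\<integral>\<^sup>+\<omega>. indicator S \<omega> * f (X \<omega>) \<partial>M)"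
  by (simp add: nn_integral_distr nn_integral_density)

text \<open>
The additivity of the process is given for continuous test functions only. These ramps carry it over
to half lines, and half lines determine a finite measure on the line.
\<close>

lemma LIMSEQ_ramp:
  "(\<lambda>n. min 1 (real n * max 0 (z - a))) \<longlonglongrightarrow> (indicator {a<..} z :: real)"
proof (cases "a < z")
  case True
  then obtain N :: nat where N: "1 < real N * (z - a)"
    using reals_Archimedean3[of "z - a"] by auto
  have "\<forall>\<^sub>F n in sequentially. min 1 (real n * max 0 (z - a)) = indicator {a<..} z"
  proof (rule eventually_sequentiallyI)
    fix n assume "N \<le> n"
    then have "real N * (z - a) \<le> real n * (z - a)" using True by (intro mult_right_mono) auto
    then have "1 < real n * (z - a)" using N by linarith
    then show "min 1 (real n * max 0 (z - a)) = indicator {a<..} z" using True by simp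
  qed
  then show ?thesis by (rule tendsto_eventually)
qed simp

text \<open>
If \<open>u\<close> carries a jump larger than \<open>e\<close>, the existence of the left limit at \<open>u\<close> excludes such jumps on some
interval \<open>{d<..<u}\<close>. The intervals of different jump times are therefore disjoint, and there are only
countably many of them.
\<close>

lemma countable_left_jumps:
  fixes b L :: "real \<Rightarrow> real"
  assumes L: "\<And>u. 0 < u \<Longrightarrow> (b \<longlongrightarrow> L u) (at_left u)"
  shows "countable {u. 0 < u \<and> L u \<noteq> b u}"
proof -
  have C: "countable {u. 0 < u \<and> e < \<bar>L u - b u\<bar>}" (is "countable ?D") if e: "0 < e" for e
  proof -
    have "\<exists>d. d < u \<and> {d<..<u} \<inter> ?D = {}" if u: "u \<in> ?D" for u
    proof -
      have u': "0 < u" "e < \<bar>L u - b u\<bar>" using u by auto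
      have "\<forall>\<^sub>F s in at_left u. dist (b s) (L u) < e / 3"
        using e by (intro tendstoD[OF L] u') simp
      then obtain d where d: "d < u" "\<And>s. d < s \<Longrightarrow> s < u \<Longrightarrow> \<bar>b s - L u\<bar> < e / 3"
        unfolding eventually_at_left_field dist_real_def by blast
      have "\<bar>L s - b s\<bar> \<le> e" if s: "0 < s" "d < s" "s < u" for s
      proof -
        have "\<forall>\<^sub>F r in at_left s. \<bar>b r - L u\<bar> \<le> e / 3"
          unfolding eventually_at_left_field
        proof (intro exI[of _ d] conjI allI impI)
          fix r assume "d < r" "r < s"
          then show "\<bar>b r - L u\<bar> \<le> e / 3" using d(2)[of r] s by linarith
        qed (use s in simp)
        then have "\<bar>L s - L u\<bar> \<le> e / 3"
          by (rule tendsto_upperbound[OF tendsto_rabs[OF tendsto_diff[OF L[OF s(1)] tendsto_const]]]) simp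
        then show ?thesis using d(2)[OF s(2,3)] by linarith
      qed
      then have "{d<..<u} \<inter> ?D = {}" by (auto simp: not_less[symmetric])
      then show ?thesis using d(1) by blast
    qed
    then have "\<forall>u\<in>?D. \<exists>d. d < u \<and> {d<..<u} \<inter> ?D = {}" by blast
    from bchoice[OF this] obtain d
      where d: "\<And>u. u \<in> ?D \<Longrightarrow> d u < u" "\<And>u. u \<in> ?D \<Longrightarrow> {d u<..<u} \<inter> ?D = {}" by blast
    have less: "{d u<..<u} \<inter> {d w<..<w} = {}" if "u \<in> ?D" "w \<in> ?D" "u < w" for u w
    proof -
      have "u \<notin> {d w<..<w}" using d(2)[OF that(2)] that(1) by blast
      then have "u \<le> d w" using that(3) by simp
      then show ?thesis by auto
    qed
    have "countable ((\<lambda>u. {d u<..<u}) ` ?D)"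
    proof (rule countable_disjoint_open_subsets)
      show "pairwise disjnt ((\<lambda>u. {d u<..<u}) ` ?D)"
      proof (rule pairwiseI)
        fix S S' assume S: "S \<in> (\<lambda>u. {d u<..<u}) ` ?D" "S' \<in> (\<lambda>u. {d u<..<u}) ` ?D" "S \<noteq> S'"
        then obtain u w where uw: "u \<in> ?D" "w \<in> ?D" "S = {d u<..<u}" "S' = {d w<..<w}" by blast
        then have "u < w \<or> w < u" using S(3) by (auto simp: neq_iff)
        then show "disjnt S S'"
          using less[OF uw(1,2)] less[OF uw(2,1)] by (auto simp only: disjnt_def uw(3,4) Int_commute)
      qed
    qed auto
    moreover have "inj_on (\<lambda>u. {d u<..<u}) ?D"
    proof (rule inj_onI)
      fix u w assume uw: "u \<in> ?D" "w \<in> ?D" "{d u<..<u} = {d w<..<w}"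
      have ne: "{d u<..<u} \<noteq> {}" using d(1)[OF uw(1)] dense[of "d u" u] by auto
      show "u = w"
      proof (rule linorder_cases[of u w])
        assume "u < w" then show ?thesis using less[OF uw(1,2)] uw(3) ne by simp
      next
        assume "w < u" then show ?thesis using less[OF uw(2,1)] uw(3) ne by simp
      qed
    qed
    ultimately show ?thesis by (rule countable_image_inj_on)
  qed
  have "{u. 0 < u \<and> L u \<noteq> b u} \<subseteq> (\<Union>n. {u. 0 < u \<and> 1 / real (Suc n) < \<bar>L u - b u\<bar>})"
  proof
    fix u assume "u \<in> {u. 0 < u \<and> L u \<noteq> b u}"
    then show "u \<in> (\<Union>n. {u. 0 < u \<and> 1 / real (Suc n) < \<bar>L u - b u\<bar>})"
      using reals_Archimedean[of "\<bar>L u - b u\<bar>"] by (auto simp: inverse_eq_divide)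
  qed
  then show ?thesis
    by (rule countable_subset) (intro countable_UN C; simp)
qed

text \<open>
Outside the countable set of jump times \<open>b\<close> is left-continuous, and approximations from the left, which
may hit \<open>u\<close> itself, see only left limits and the value at \<open>u\<close>.
\<close>

lemma AE_LIMSEQ_left:
  fixes b :: "real \<Rightarrow> real" and s :: "nat \<Rightarrow> real \<Rightarrow> real"
  assumes L: "\<And>u. 0 < u \<Longrightarrow> \<exists>L. (b \<longlongrightarrow> L) (at_left u)"
    and s: "\<And>n u. s n u \<le> u" "\<And>u. (\<lambda>n. s n u) \<longlonglongrightarrow> u"
  shows "AE u in lborel. 0 < u \<longrightarrow> (\<lambda>n. b (s n u)) \<longlonglongrightarrow> b u"
proof -
  obtain L where L: "\<And>u. 0 < u \<Longrightarrow> (b \<longlongrightarrow> L u) (at_left u)" using L by metis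
  have "AE u in lborel. u \<notin> {u. 0 < u \<and> L u \<noteq> b u}"
    by (rule AE_not_in[OF countable_imp_null_set_lborel[OF countable_left_jumps[OF L]]])
  then show ?thesis
  proof eventually_elim
    case (elim u)
    show ?case
    proof
      assume u: "0 < u"
      then have l: "(b \<longlongrightarrow> b u) (at_left u)" using elim L[OF u] by auto
      show "(\<lambda>n. b (s n u)) \<longlonglongrightarrow> b u"
      proof (rule tendstoI)
        fix e :: real assume e: "0 < e"
        obtain d where d: "d < u" "\<And>r. d < r \<Longrightarrow> r < u \<Longrightarrow> dist (b r) (b u) < e"
          using tendstoD[OF l e] by (auto simp: eventually_at_left_field)
        have "\<forall>\<^sub>F n in sequentially. d < s n u"
          using order_tendstoD(1)[OF s(2) d(1)] .
        then show "\<forall>\<^sub>F n in sequentially. dist (b (s n u)) (b u) < e"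
        proof eventually_elim
          case (elim n)
          then show ?case using d(2)[of "s n u"] s(1)[of n u] e by (cases "s n u = u") auto
        qed
      qed
    qed
  qed
qed

definition grid :: "nat \<Rightarrow> real \<Rightarrow> real" where
  "grid n u = real_of_int \<lfloor>real (Suc n) * u\<rfloor> / real (Suc n)"

lemma grid_le: "grid n u \<le> u"
  unfolding grid_def by (simp add: divide_le_eq mult.commute del: of_nat_Suc)

lemma grid_ge: "u - 1 / real (Suc n) \<le> grid n u"
proof -
  have "real (Suc n) * u - 1 \<le> real_of_int \<lfloor>real (Suc n) * u\<rfloor>" by linarith
  then have "(real (Suc n) * u - 1) / real (Suc n) \<le> grid n u"
    unfolding grid_def by (rule divide_right_mono) simp
  then show ?thesis by (simp add: diff_divide_distrib del: of_nat_Suc)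
qed

lemma LIMSEQ_grid: "(\<lambda>n. grid n u) \<longlonglongrightarrow> u"
proof -
  have "(\<lambda>n. u - 1 / real (Suc n)) \<longlonglongrightarrow> u"
    using tendsto_diff[OF tendsto_const LIMSEQ_inverse_real_of_nat, of u] by (simp add: inverse_eq_divide)
  then show ?thesis
    by (rule tendsto_sandwich[rotated 2, OF _ tendsto_const]) (intro always_eventually allI grid_le grid_ge)+
qed

lemma grid_cell:
  assumes "i < Suc n"
  shows "u \<in> {real i / real (Suc n)..<real i / real (Suc n) + 1 / real (Suc n)} \<longleftrightarrow> \<lfloor>real (Suc n) * u\<rfloor> = int i"
  by (simp add: floor_eq_iff field_simps del: of_nat_Suc)

text \<open>
Splits the unit interval into the \<open>Suc n\<close> cells of the grid, on each of which the left end point is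
a constant time and the Markov property can be applied.
\<close>

lemma grid_decomposition:
  fixes f :: "real \<Rightarrow> real \<Rightarrow> ennreal"
  shows "f (grid n u) u * indicator {0..<1} u
    = (\<Sum>i<Suc n. f (real i / real (Suc n)) u * indicator {real i / real (Suc n)..<real i / real (Suc n) + 1 / real (Suc n)} u)"
proof (cases "u \<in> {0..<1}")
  case True
  define k where "k = nat \<lfloor>real (Suc n) * u\<rfloor>"
  have k: "int k = \<lfloor>real (Suc n) * u\<rfloor>" using True by (simp add: k_def)
  have g: "grid n u = real k / real (Suc n)" by (simp only: grid_def k[symmetric] of_int_of_nat_eq)
  have "real (Suc n) * u < real (Suc n)" using True by simp
  then have "\<lfloor>real (Suc n) * u\<rfloor> < int (Suc n)" by (simp add: floor_less_iff)
  then have kn: "k < Suc n" using k by linarith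
  have "(\<Sum>i<Suc n. f (real i / real (Suc n)) u * indicator {real i / real (Suc n)..<real i / real (Suc n) + 1 / real (Suc n)} u)
    = (\<Sum>i<Suc n. if i = k then f (grid n u) u else 0)"
  proof (rule sum.cong[OF refl])
    fix i assume "i \<in> {..<Suc n}"
    then have "u \<in> {real i / real (Suc n)..<real i / real (Suc n) + 1 / real (Suc n)} \<longleftrightarrow> i = k"
      using grid_cell[of i n u] k by auto
    then show "f (real i / real (Suc n)) u * indicator {real i / real (Suc n)..<real i / real (Suc n) + 1 / real (Suc n)} u
      = (if i = k then f (grid n u) u else 0)"
      using g by (cases "i = k") (simp_all add: indicator_def del: of_nat_Suc)
  qed
  also have "\<dots> = f (grid n u) u" using kn by simp
  finally show ?thesis using True by simp
next
  case False
  have "u \<notin> {real i / real (Suc n)..<real i / real (Suc n) + 1 / real (Suc n)}" if "i < Suc n" for i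
  proof
    assume "u \<in> {real i / real (Suc n)..<real i / real (Suc n) + 1 / real (Suc n)}"
    then have u: "real i / real (Suc n) \<le> u" "u < (real i + 1) / real (Suc n)"
      by (auto simp: add_divide_distrib)
    have "0 \<le> u" by (rule order_trans[OF _ u(1)]) simp
    moreover have "u < 1" by (rule less_le_trans[OF u(2)]) (use that in simp)
    ultimately show False using False by simp
  qed
  then show ?thesis using False by (auto intro!: sum.neutral[symmetric])
qed

section \<open>The Markov property of the pair\<close>

context markov_additive_process
begin

lemma measurable_path:
  assumes "0 \<le> t"
  shows "J t \<in> measurable (P \<alpha> x) (count_space UNIV)" "\<xi> t \<in> borel_measurable (P \<alpha> x)"
  using measurable_from_subalg[OF subalgebra_F[OF assms] adapted_J[OF assms]]
    measurable_from_subalg[OF subalgebra_F[OF assms] adapted_xi[OF assms]] by auto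

text \<open>
Paths are only controlled at nonnegative times. Clipping the time at \<open>0\<close> gives processes that are
jointly measurable on the whole line.
\<close>

abbreviation Jp :: "real \<Rightarrow> 'a \<Rightarrow> 'e" where "Jp t \<equiv> J (max 0 t)"
abbreviation Xp :: "real \<Rightarrow> 'a \<Rightarrow> real" where "Xp t \<equiv> \<xi> (max 0 t)"

lemma measurable_joint [measurable]:
  "(\<lambda>p. Xp (fst p) (snd p)) \<in> borel_measurable (borel \<Otimes>\<^sub>M P \<alpha> x)"
  "(\<lambda>p. Jp (fst p) (snd p)) \<in> measurable (borel \<Otimes>\<^sub>M P \<alpha> x) (count_space UNIV)"
proof -
  show "(\<lambda>p. Xp (fst p) (snd p)) \<in> borel_measurable (borel \<Otimes>\<^sub>M P \<alpha> x)"
    using jointly_measurable_right_continuous[of \<xi> "P \<alpha> x"] measurable_path(2) xi_right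
    by (simp add: space_P case_prod_unfold)
  let ?n = "\<lambda>j::'e. real (to_nat j)"
  have "(\<lambda>p. ?n (Jp (fst p) (snd p))) \<in> borel_measurable (borel \<Otimes>\<^sub>M P \<alpha> x)"
  proof -
    have 1: "(\<lambda>\<omega>. ?n (J t \<omega>)) \<in> borel_measurable (P \<alpha> x)" if "0 \<le> t" for t
      using measurable_compose[OF measurable_path(1)[OF that], of ?n borel] by simp
    have 2: "((\<lambda>s. ?n (J s \<omega>)) \<longlongrightarrow> ?n (J t \<omega>)) (at_right t)" if "\<omega> \<in> \<Omega>" "0 \<le> t" for t \<omega>
      by (rule tendsto_eventually) (use J_right[OF that] in \<open>auto elim: eventually_mono\<close>)
    show ?thesis
      using jointly_measurable_right_continuous[of "\<lambda>t \<omega>. ?n (J t \<omega>)" "P \<alpha> x"] 1 2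
      by (simp add: space_P case_prod_unfold)
  qed
  then have "(\<lambda>p. from_nat (nat \<lfloor>?n (Jp (fst p) (snd p))\<rfloor>) :: 'e)
      \<in> measurable (borel \<Otimes>\<^sub>M P \<alpha> x) (count_space UNIV)"
    by measurable
  then show "(\<lambda>p. Jp (fst p) (snd p)) \<in> measurable (borel \<Otimes>\<^sub>M P \<alpha> x) (count_space UNIV)"
    by simp
qed

text \<open>
A state lies in a finite set times the line, and a function of it is best handled in curried form:
measurability in the second argument suffices because the first takes countably many values.
\<close>

lemma measurable_state:
  assumes [measurable]: "j \<in> measurable N (count_space (UNIV::'e set))" "z \<in> borel_measurable N"
    and [measurable]: "\<And>\<beta>. (\<lambda>y. w \<beta> y) \<in> borel_measurable borel"
  shows "(\<lambda>p. w (j p) (z p)) \<in> borel_measurable N"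
  by (rule measurable_compose_countable[where g=j and f="\<lambda>i p. w i (z p)"]) measurable

text \<open>
Additivity is given for positive times; for \<open>t = 0\<close> it follows by letting \<open>t\<close> decrease to \<open>0\<close>, using right
continuity of the paths. The case \<open>t = 0\<close> is what says that the law of the process started
at \<open>x\<close> is that of the process started at \<open>0\<close>, shifted by \<open>x\<close>.
\<close>

lemma increment_conditional:
  assumes t: "0 \<le> t" and s: "0 < s" and A: "A \<in> sets (F t)"
    and f: "\<And>\<beta>. continuous_on UNIV (f \<beta>)" "\<And>\<beta> z. 0 \<le> f \<beta> z" "\<And>\<beta> z. f \<beta> z \<le> (B::real)"
  shows "(\<integral>\<omega>. indicator A \<omega> * f (J (t + s) \<omega>) (\<xi> (t + s) \<omega> - \<xi> t \<omega>) \<partial>P \<alpha> x)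
       = (\<integral>\<omega>. indicator A \<omega> * (\<integral>\<omega>'. f (J s \<omega>') (\<xi> s \<omega>') \<partial>P (J t \<omega>) 0) \<partial>P \<alpha> x)"
proof -
  interpret a: prob_space "P \<alpha> x" by (rule prob_space)
  have fm[measurable]: "f \<beta> \<in> borel_measurable borel" for \<beta>
    using f(1) by (simp add: borel_measurable_continuous_onI)
  let ?R = "\<lambda>\<beta>. \<integral>\<omega>'. f (J s \<omega>') (\<xi> s \<omega>') \<partial>P \<beta> 0"
  have B: "0 \<le> B" using f(2,3)[of undefined 0] by (rule order_trans)
  have R: "?R \<beta> \<in> {0..B}" for \<beta>
  proof -
    interpret b: prob_space "P \<beta> 0" by (rule prob_space)
    have "?R \<beta> \<le> (\<integral>\<omega>. B \<partial>P \<beta> 0)"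
      using f(2,3) B by (intro Bochner_Integration.integral_mono_AE' b.integrable_const) auto
    then show ?thesis using f(2) by (auto intro!: integral_nonneg simp: b.prob_space)
  qed
  have M: "(\<lambda>\<omega>. f (J (t + s) \<omega>) (\<xi> (t + s) \<omega> - \<xi> t \<omega>)) \<in> borel_measurable (P \<alpha> x)" if "0 \<le> t" for t
    by (rule measurable_state[where w=f], rule measurable_path)
      (use s that in \<open>auto intro!: borel_measurable_diff measurable_path\<close>)
  have RJ: "(\<lambda>\<omega>. ?R (J t \<omega>)) \<in> borel_measurable (P \<alpha> x)" if "0 \<le> t" for t
    by (rule measurable_compose[OF measurable_path(1)[OF that]]) simp
  have A': "A \<in> sets (P \<alpha> x)" using A subalgebra_F[OF t] by (auto simp: subalgebra_def)
  have pos: "(\<integral>\<omega>. indicator A \<omega> * f (J (t + s) \<omega>) (\<xi> (t + s) \<omega> - \<xi> t \<omega>) \<partial>P \<alpha> x)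
       = (\<integral>\<omega>. indicator A \<omega> * ?R (J t \<omega>) \<partial>P \<alpha> x)" if t: "0 < t" and A: "A \<in> sets (F t)" for t
  proof -
    interpret finite_measure_subalgebra "P \<alpha> x" "F t"
      by unfold_locales (use subalgebra_F t in auto)
    have int: "integrable (P \<alpha> x) (\<lambda>\<omega>. f (J (t + s) \<omega>) (\<xi> (t + s) \<omega> - \<xi> t \<omega>))"
      using f(2,3) M t by (intro a.integrable_const_bound[of _ B]) auto
    have "(\<integral>\<omega>. indicator A \<omega> * f (J (t + s) \<omega>) (\<xi> (t + s) \<omega> - \<xi> t \<omega>) \<partial>P \<alpha> x)
      = (\<integral>\<omega>. indicator A \<omega> * real_cond_exp (P \<alpha> x) (F t)
            (\<lambda>\<omega>. f (J (t + s) \<omega>) (\<xi> (t + s) \<omega> - \<xi> t \<omega>)) \<omega> \<partial>P \<alpha> x)"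
      using real_cond_exp_intA[OF int A] by (simp add: set_lebesgue_integral_def)
    also have "\<dots> = (\<integral>\<omega>. indicator A \<omega> * ?R (J t \<omega>) \<partial>P \<alpha> x)"
    proof (rule integral_cong_AE)
      show "AE \<omega> in P \<alpha> x. indicator A \<omega> * real_cond_exp (P \<alpha> x) (F t)
            (\<lambda>\<omega>. f (J (t + s) \<omega>) (\<xi> (t + s) \<omega> - \<xi> t \<omega>)) \<omega> = indicator A \<omega> * ?R (J t \<omega>)"
      proof -
        have "\<exists>B. \<forall>\<beta> z. f \<beta> z \<le> B" using f(3) by blast
        from markov_additive[OF s t f(1,2) this, of \<alpha> x] show ?thesis
          by eventually_elim simp
      qed
      have [measurable]: "A \<in> sets (P \<alpha> x)" by fact
      show "(\<lambda>\<omega>. indicator A \<omega> * ?R (J t \<omega>)) \<in> borel_measurable (P \<alpha> x)"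
        using t by (intro borel_measurable_times borel_measurable_indicator RJ) auto
    qed (use A' in measurable)
    finally show ?thesis .
  qed
  show ?thesis
  proof (cases "t = 0")
    case False
    then show ?thesis using pos[of t] t A by simp
  next
    case True
    \<comment> \<open>times decreasing to \<open>0\<close>\<close>
    define e where "e n = 1 / real (Suc n)" for n
    have e: "0 < e n" for n by (simp add: e_def)
    have [measurable]: "A \<in> sets (P \<alpha> x)" by fact
    have er: "filterlim (\<lambda>n. c + e n) (at_right c) sequentially" for c
      by (rule tendsto_imp_filterlim_at_right)
        (use tendsto_add[OF tendsto_const LIMSEQ_inverse_real_of_nat, of c] in
          \<open>auto simp: e_def inverse_eq_divide\<close>)
    have eq: "(\<integral>\<omega>. indicator A \<omega> * f (J (e n + s) \<omega>) (\<xi> (e n + s) \<omega> - \<xi> (e n) \<omega>) \<partial>P \<alpha> x)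
       = (\<integral>\<omega>. indicator A \<omega> * ?R (J (e n) \<omega>) \<partial>P \<alpha> x)" for n
    proof (rule pos[OF e])
      show "A \<in> sets (F (e n))"
        using A True F_mono[OF order_refl less_imp_le[OF e[of n]]] by (simp add: subset_iff)
    qed
    have l1: "(\<lambda>n. \<integral>\<omega>. indicator A \<omega> * f (J (e n + s) \<omega>) (\<xi> (e n + s) \<omega> - \<xi> (e n) \<omega>) \<partial>P \<alpha> x)
      \<longlonglongrightarrow> (\<integral>\<omega>. indicator A \<omega> * f (J (t + s) \<omega>) (\<xi> (t + s) \<omega> - \<xi> t \<omega>) \<partial>P \<alpha> x)"
    proof (rule integral_dominated_convergence[where w="\<lambda>_. B"])
      show "(\<lambda>\<omega>. indicator A \<omega> * f (J (t + s) \<omega>) (\<xi> (t + s) \<omega> - \<xi> t \<omega>)) \<in> borel_measurable (P \<alpha> x)"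
        using M[OF t] by measurable
      show "(\<lambda>\<omega>. indicator A \<omega> * f (J (e n + s) \<omega>) (\<xi> (e n + s) \<omega> - \<xi> (e n) \<omega>)) \<in> borel_measurable (P \<alpha> x)" for n
        using M[OF less_imp_le[OF e]] by measurable
      show "AE \<omega> in P \<alpha> x. norm (indicator A \<omega> * f (J (e n + s) \<omega>) (\<xi> (e n + s) \<omega> - \<xi> (e n) \<omega>)) \<le> B" for n
        using f(2,3) B by (auto simp: indicator_def)
      show "AE \<omega> in P \<alpha> x. (\<lambda>n. indicator A \<omega> * f (J (e n + s) \<omega>) (\<xi> (e n + s) \<omega> - \<xi> (e n) \<omega>))
         \<longlonglongrightarrow> indicator A \<omega> * f (J (t + s) \<omega>) (\<xi> (t + s) \<omega> - \<xi> t \<omega>)"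
      proof (rule AE_I2, intro tendsto_intros)
        fix \<omega> assume "\<omega> \<in> space (P \<alpha> x)"
        then have w: "\<omega> \<in> \<Omega>" by (simp add: space_P)
        have 1: "\<forall>\<^sub>F n in sequentially. J (s + e n) \<omega> = J s \<omega>"
          using eventually_compose_filterlim[OF J_right[OF w less_imp_le[OF s]] er[of s]] .
        have 2: "(\<lambda>n. \<xi> (s + e n) \<omega>) \<longlonglongrightarrow> \<xi> s \<omega>"
          using filterlim_compose[OF xi_right[OF w less_imp_le[OF s]] er[of s]] .
        have 3: "(\<lambda>n. \<xi> (0 + e n) \<omega>) \<longlonglongrightarrow> \<xi> 0 \<omega>"
          using filterlim_compose[OF xi_right[OF w order_refl] er[of 0]] .
        have L: "(\<lambda>n. f (J s \<omega>) (\<xi> (s + e n) \<omega> - \<xi> (e n) \<omega>)) \<longlonglongrightarrow> f (J s \<omega>) (\<xi> s \<omega> - \<xi> 0 \<omega>)"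
          using f(1)[of "J s \<omega>"] tendsto_diff[OF 2 3]
          by (auto simp: continuous_on_eq_continuous_at intro: isCont_tendsto_compose)
        have "(\<lambda>n. f (J (s + e n) \<omega>) (\<xi> (s + e n) \<omega> - \<xi> (e n) \<omega>)) \<longlonglongrightarrow> f (J s \<omega>) (\<xi> s \<omega> - \<xi> 0 \<omega>)"
          by (rule Lim_transform_eventually[OF L]) (use 1 in \<open>auto elim!: eventually_mono\<close>)
        then show "(\<lambda>n. f (J (e n + s) \<omega>) (\<xi> (e n + s) \<omega> - \<xi> (e n) \<omega>)) \<longlonglongrightarrow>
            f (J (t + s) \<omega>) (\<xi> (t + s) \<omega> - \<xi> t \<omega>)"
          by (simp add: True add.commute)
      qed
    qed simp
    have l2: "(\<lambda>n. \<integral>\<omega>. indicator A \<omega> * ?R (J (e n) \<omega>) \<partial>P \<alpha> x)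
      \<longlonglongrightarrow> (\<integral>\<omega>. indicator A \<omega> * ?R (J t \<omega>) \<partial>P \<alpha> x)"
    proof (rule integral_dominated_convergence[where w="\<lambda>_. B"])
      have R': "(\<lambda>\<omega>. indicator A \<omega> * ?R (J t \<omega>)) \<in> borel_measurable (P \<alpha> x)" if "0 \<le> t" for t
        using that A' by (intro borel_measurable_times borel_measurable_indicator RJ) auto
      show "(\<lambda>\<omega>. indicator A \<omega> * ?R (J t \<omega>)) \<in> borel_measurable (P \<alpha> x)" using R' t .
      show "(\<lambda>\<omega>. indicator A \<omega> * ?R (J (e n) \<omega>)) \<in> borel_measurable (P \<alpha> x)" for n
        using R' less_imp_le[OF e] .
      show "AE \<omega> in P \<alpha> x. norm (indicator A \<omega> * ?R (J (e n) \<omega>)) \<le> B" for n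
        using R B by (auto simp: indicator_def)
      show "AE \<omega> in P \<alpha> x. (\<lambda>n. indicator A \<omega> * ?R (J (e n) \<omega>)) \<longlonglongrightarrow> indicator A \<omega> * ?R (J t \<omega>)"
      proof (rule AE_I2, intro tendsto_intros)
        fix \<omega> assume "\<omega> \<in> space (P \<alpha> x)"
        then have "\<forall>\<^sub>F n in sequentially. J (0 + e n) \<omega> = J 0 \<omega>"
          by (intro eventually_compose_filterlim[OF J_right er]) (simp_all add: space_P)
        then show "(\<lambda>n. ?R (J (e n) \<omega>)) \<longlonglongrightarrow> ?R (J t \<omega>)"
          by (intro tendsto_eventually) (use True in \<open>auto elim!: eventually_mono\<close>)
      qed
    qed simp
    show ?thesis using LIMSEQ_unique[OF l1[unfolded eq] l2] .
  qed
qed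

lemma sets_state:
  assumes "0 \<le> t"
  shows "{\<omega> \<in> \<Omega>. J t \<omega> = \<beta>} \<in> sets (P \<alpha> x)" "{\<omega> \<in> \<Omega>. J t \<omega> = \<beta>} \<in> sets (F t)"
proof -
  show "{\<omega> \<in> \<Omega>. J t \<omega> = \<beta>} \<in> sets (P \<alpha> x)"
    using measurable_sets[OF measurable_path(1)[OF assms], of "{\<beta>}" \<alpha> x]
    by (simp add: vimage_def Int_def conj_commute space_P)
  have "space (F t) = \<Omega>"
    using subalgebra_F[OF assms, of \<alpha> x] by (simp add: subalgebra_def space_P)
  then show "{\<omega> \<in> \<Omega>. J t \<omega> = \<beta>} \<in> sets (F t)"
    using measurable_sets[OF adapted_J[OF assms], of "{\<beta>}"]
    by (simp add: vimage_def Int_def conj_commute)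
qed

lemma increment_tail:
  assumes t: "0 \<le> t" and s: "0 < s" and A: "A \<in> sets (F t)" and J: "\<And>\<omega>. \<omega> \<in> A \<Longrightarrow> J t \<omega> = \<beta>"
  shows "measure (P \<alpha> x) (A \<inter> {\<omega> \<in> \<Omega>. J (t + s) \<omega> = \<gamma> \<and> a < \<xi> (t + s) \<omega> - \<xi> t \<omega>})
       = measure (P \<alpha> x) A * measure (P \<beta> 0) {\<omega> \<in> \<Omega>. J s \<omega> = \<gamma> \<and> a < \<xi> s \<omega>}"
proof -
  interpret a: prob_space "P \<alpha> x" by (rule prob_space)
  interpret b: prob_space "P \<beta> 0" by (rule prob_space)
  have [measurable]: "A \<in> sets (P \<alpha> x)" using A subalgebra_F[OF t] by (auto simp: subalgebra_def)
  define f where "f n \<delta> z = (if \<delta> = \<gamma> then min 1 (real n * max 0 (z - a)) else 0)" for n \<delta> z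
  define g where "g \<delta> z = (if \<delta> = \<gamma> then indicator {a<..} z else 0 :: real)" for \<delta> z
  have f: "continuous_on UNIV (f n \<delta>)" "0 \<le> f n \<delta> z" "f n \<delta> z \<le> 1" for n \<delta> z
    unfolding f_def by (cases "\<delta> = \<gamma>"; auto intro!: continuous_intros)+
  have lim: "(\<lambda>n. f n \<delta> z) \<longlonglongrightarrow> g \<delta> z" for \<delta> z
    unfolding f_def g_def using LIMSEQ_ramp[of z a] by simp
  have fm[measurable]: "f n \<delta> \<in> borel_measurable borel" for n \<delta>
    using f(1) by (simp add: borel_measurable_continuous_onI)
  have gm[measurable]: "g \<delta> \<in> borel_measurable borel" for \<delta>
    unfolding g_def by measurable
  have Z: "J (t + s) \<in> measurable (P \<alpha> x) (count_space UNIV)"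
    "(\<lambda>\<omega>. \<xi> (t + s) \<omega> - \<xi> t \<omega>) \<in> borel_measurable (P \<alpha> x)"
    "J s \<in> measurable (P \<beta> 0) (count_space UNIV)" "\<xi> s \<in> borel_measurable (P \<beta> 0)"
    using t s by (auto intro!: borel_measurable_diff measurable_path)
  have state: "(\<lambda>\<omega>. h (J (t + s) \<omega>) (\<xi> (t + s) \<omega> - \<xi> t \<omega>)) \<in> borel_measurable (P \<alpha> x)"
    "(\<lambda>\<omega>. h (J s \<omega>) (\<xi> s \<omega>)) \<in> borel_measurable (P \<beta> 0)"
    if "\<And>\<delta>. h \<delta> \<in> borel_measurable borel" for h :: "'e \<Rightarrow> real \<Rightarrow> real"
    by (rule measurable_state[where w=h, OF Z(1,2) that], rule measurable_state[where w=h, OF Z(3,4) that])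
  have l1: "(\<lambda>n. \<integral>\<omega>. indicator A \<omega> * f n (J (t + s) \<omega>) (\<xi> (t + s) \<omega> - \<xi> t \<omega>) \<partial>P \<alpha> x)
      \<longlonglongrightarrow> (\<integral>\<omega>. indicator A \<omega> * g (J (t + s) \<omega>) (\<xi> (t + s) \<omega> - \<xi> t \<omega>) \<partial>P \<alpha> x)"
  proof (rule integral_dominated_convergence[where w="\<lambda>_. 1"])
    show "(\<lambda>\<omega>. indicator A \<omega> * g (J (t + s) \<omega>) (\<xi> (t + s) \<omega> - \<xi> t \<omega>)) \<in> borel_measurable (P \<alpha> x)"
      by (intro borel_measurable_times borel_measurable_indicator state gm) fact
    show "(\<lambda>\<omega>. indicator A \<omega> * f n (J (t + s) \<omega>) (\<xi> (t + s) \<omega> - \<xi> t \<omega>)) \<in> borel_measurable (P \<alpha> x)" for n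
      by (intro borel_measurable_times borel_measurable_indicator state fm) fact
    show "AE \<omega> in P \<alpha> x. norm (indicator A \<omega> * f n (J (t + s) \<omega>) (\<xi> (t + s) \<omega> - \<xi> t \<omega>)) \<le> 1" for n
      using f(2,3) by (auto simp: indicator_def)
  qed (auto intro!: tendsto_intros lim)
  have l2: "(\<lambda>n. \<integral>\<omega>. f n (J s \<omega>) (\<xi> s \<omega>) \<partial>P \<beta> 0) \<longlonglongrightarrow> (\<integral>\<omega>. g (J s \<omega>) (\<xi> s \<omega>) \<partial>P \<beta> 0)"
  proof (rule integral_dominated_convergence[where w="\<lambda>_. 1"])
    show "(\<lambda>\<omega>. g (J s \<omega>) (\<xi> s \<omega>)) \<in> borel_measurable (P \<beta> 0)"
      by (intro state gm)
    show "(\<lambda>\<omega>. f n (J s \<omega>) (\<xi> s \<omega>)) \<in> borel_measurable (P \<beta> 0)" for n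
      by (intro state fm)
    show "AE \<omega> in P \<beta> 0. norm (f n (J s \<omega>) (\<xi> s \<omega>)) \<le> 1" for n
      using f(2,3) by auto
  qed (auto intro!: tendsto_intros lim)
  have eq: "(\<integral>\<omega>. indicator A \<omega> * f n (J (t + s) \<omega>) (\<xi> (t + s) \<omega> - \<xi> t \<omega>) \<partial>P \<alpha> x)
      = measure (P \<alpha> x) A * (\<integral>\<omega>. f n (J s \<omega>) (\<xi> s \<omega>) \<partial>P \<beta> 0)" for n
  proof -
    have "(\<integral>\<omega>. indicator A \<omega> * f n (J (t + s) \<omega>) (\<xi> (t + s) \<omega> - \<xi> t \<omega>) \<partial>P \<alpha> x)
      = (\<integral>\<omega>. indicator A \<omega> * (\<integral>\<omega>'. f n (J s \<omega>') (\<xi> s \<omega>') \<partial>P (J t \<omega>) 0) \<partial>P \<alpha> x)"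
      by (rule increment_conditional[OF t s A f])
    also have "\<dots> = (\<integral>\<omega>. indicator A \<omega> * (\<integral>\<omega>'. f n (J s \<omega>') (\<xi> s \<omega>') \<partial>P \<beta> 0) \<partial>P \<alpha> x)"
      by (intro Bochner_Integration.integral_cong) (auto simp: indicator_def J)
    also have "\<dots> = measure (P \<alpha> x) A * (\<integral>\<omega>. f n (J s \<omega>) (\<xi> s \<omega>) \<partial>P \<beta> 0)"
      by (simp add: integral_mult_left_zero)
    finally show ?thesis .
  qed
  have "(\<integral>\<omega>. indicator A \<omega> * g (J (t + s) \<omega>) (\<xi> (t + s) \<omega> - \<xi> t \<omega>) \<partial>P \<alpha> x)
      = measure (P \<alpha> x) A * (\<integral>\<omega>. g (J s \<omega>) (\<xi> s \<omega>) \<partial>P \<beta> 0)"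
    using LIMSEQ_unique[OF l1 tendsto_mult_left[OF l2, of "measure (P \<alpha> x) A", folded eq]] .
  moreover have "(\<integral>\<omega>. indicator A \<omega> * g (J (t + s) \<omega>) (\<xi> (t + s) \<omega> - \<xi> t \<omega>) \<partial>P \<alpha> x)
      = (\<integral>\<omega>. indicator (A \<inter> {\<omega> \<in> \<Omega>. J (t + s) \<omega> = \<gamma> \<and> a < \<xi> (t + s) \<omega> - \<xi> t \<omega>}) \<omega> \<partial>P \<alpha> x)"
    by (intro Bochner_Integration.integral_cong) (auto simp: indicator_def g_def space_P)
  moreover have "(\<integral>\<omega>. g (J s \<omega>) (\<xi> s \<omega>) \<partial>P \<beta> 0)
      = (\<integral>\<omega>. indicator {\<omega> \<in> \<Omega>. J s \<omega> = \<gamma> \<and> a < \<xi> s \<omega>} \<omega> \<partial>P \<beta> 0)"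
    by (intro Bochner_Integration.integral_cong) (auto simp: indicator_def g_def space_P)
  moreover have "A \<subseteq> \<Omega>" using sets.sets_into_space[of A "P \<alpha> x"] by (auto simp: space_P)
  ultimately show ?thesis by (simp add: space_P Int_absorb2 le_infI1)
qed

text \<open>
Both sides are finite measures in \<open>B\<close> that agree on half lines. Unlike the conditional expectations
above, this form makes visible that, given the modulator at time \<open>t\<close>, the past is independent of the
increment and of the later modulator.
\<close>

lemma increment_law:
  assumes t: "0 \<le> t" and s: "0 < s" and A: "A \<in> sets (F t)" and J: "\<And>\<omega>. \<omega> \<in> A \<Longrightarrow> J t \<omega> = \<beta>"
    and B: "B \<in> sets borel"
  shows "emeasure (P \<alpha> x) (A \<inter> {\<omega> \<in> \<Omega>. J (t + s) \<omega> = \<gamma> \<and> \<xi> (t + s) \<omega> - \<xi> t \<omega> \<in> B})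
       = emeasure (P \<alpha> x) A * emeasure (P \<beta> 0) {\<omega> \<in> \<Omega>. J s \<omega> = \<gamma> \<and> \<xi> s \<omega> \<in> B}"
proof -
  interpret a: prob_space "P \<alpha> x" by (rule prob_space)
  interpret b: prob_space "P \<beta> 0" by (rule prob_space)
  have A'[measurable]: "A \<in> sets (P \<alpha> x)" using A subalgebra_F[OF t] by (auto simp: subalgebra_def)
  let ?S = "A \<inter> {\<omega> \<in> \<Omega>. J (t + s) \<omega> = \<gamma>}" and ?S' = "{\<omega> \<in> \<Omega>. J s \<omega> = \<gamma>}"
  let ?c = "emeasure (P \<alpha> x) A"
  define N1 where "N1 = distr (density (P \<alpha> x) (\<lambda>\<omega>. 1 * indicator ?S \<omega>)) borel (\<lambda>\<omega>. \<xi> (t + s) \<omega> - \<xi> t \<omega>)"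
  define N2 where "N2 = distr (density (P \<beta> 0) (\<lambda>\<omega>. ?c * indicator ?S' \<omega>)) borel (\<xi> s)"
  have m1: "?S \<in> sets (P \<alpha> x)" using A' sets_state(1)[of "t + s"] t s by auto
  have m2: "?S' \<in> sets (P \<beta> 0)" using sets_state(1)[of s] s by auto
  have m3: "(\<lambda>\<omega>. \<xi> (t + s) \<omega> - \<xi> t \<omega>) \<in> borel_measurable (P \<alpha> x)" "\<xi> s \<in> borel_measurable (P \<beta> 0)"
    using t s by (auto intro!: borel_measurable_diff measurable_path)
  have N1: "emeasure N1 B = emeasure (P \<alpha> x) (A \<inter> {\<omega> \<in> \<Omega>. J (t + s) \<omega> = \<gamma> \<and> \<xi> (t + s) \<omega> - \<xi> t \<omega> \<in> B})"
    if "B \<in> sets borel" for B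
    unfolding N1_def using emeasure_distr_density_indicator[OF m1 m3(1) that, of 1]
    by (auto simp: space_P intro!: arg_cong[where f="emeasure (P \<alpha> x)"])
  have N2: "emeasure N2 B = ?c * emeasure (P \<beta> 0) {\<omega> \<in> \<Omega>. J s \<omega> = \<gamma> \<and> \<xi> s \<omega> \<in> B}"
    if "B \<in> sets borel" for B
    unfolding N2_def using emeasure_distr_density_indicator[OF m2 m3(2) that, of ?c]
    by (auto simp: space_P intro!: arg_cong[where f="\<lambda>S. ?c * emeasure (P \<beta> 0) S"])
  have "N1 = N2"
  proof (rule measure_eqI_lessThan)
    fix a :: real
    show "emeasure N1 {a<..} < \<infinity>" using N1[of "{a<..}"] by (simp add: less_top[symmetric])
    show "emeasure N1 {a<..} = emeasure N2 {a<..}"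
      using increment_tail[OF t s A J, where a=a and \<alpha>=\<alpha> and x=x and \<gamma>=\<gamma>]
      by (simp add: N1 N2 a.emeasure_eq_measure b.emeasure_eq_measure ennreal_mult)
  qed (simp_all add: N1_def N2_def)
  then show ?thesis using N1[OF B] N2[OF B] by simp
qed

text \<open>
The transition operator of the pair, written through the law started at position \<open>0\<close>; this form makes
its measurability in \<open>z\<close> and its invariance under translations evident.
\<close>

definition transition :: "real \<Rightarrow> ('e \<Rightarrow> real \<Rightarrow> ennreal) \<Rightarrow> 'e \<Rightarrow> real \<Rightarrow> ennreal" where
  "transition s w \<beta> z = (\<integral>\<^sup>+\<omega>. w (J s \<omega>) (\<xi> s \<omega> + z) \<partial>P \<beta> 0)"

text \<open>
On the event that the modulator passes through \<open>\<beta>\<close> at time \<open>t\<close> and \<open>\<gamma>\<close> at time \<open>t + s\<close>, the position and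
the increment have a product law; the statement is Fubini's theorem for this product, summed over the
finitely many \<open>\<beta>\<close> and \<open>\<gamma>\<close>.
\<close>

lemma markov_positive_lag:
  assumes t: "0 \<le> t" and s: "0 < s"
    and v[measurable]: "\<And>\<beta>. v \<beta> \<in> borel_measurable borel"
    and w[measurable]: "\<And>\<beta>. w \<beta> \<in> borel_measurable borel"
  shows "(\<integral>\<^sup>+\<omega>. v (J t \<omega>) (\<xi> t \<omega>) * w (J (t + s) \<omega>) (\<xi> (t + s) \<omega>) \<partial>P \<alpha> x)
       = (\<integral>\<^sup>+\<omega>. v (J t \<omega>) (\<xi> t \<omega>) * transition s w (J t \<omega>) (\<xi> t \<omega>) \<partial>P \<alpha> x)"
proof -
  interpret a: prob_space "P \<alpha> x" by (rule prob_space)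
  let ?A = "\<lambda>\<beta>. {\<omega> \<in> \<Omega>. J t \<omega> = \<beta>}" and ?C = "\<lambda>\<gamma>. {\<omega> \<in> \<Omega>. J (t + s) \<omega> = \<gamma>}" and ?D = "\<lambda>\<gamma>. {\<omega> \<in> \<Omega>. J s \<omega> = \<gamma>}"
  have ts: "0 \<le> t + s" "0 \<le> s" using t s by auto
  have [measurable]: "?A \<beta> \<in> sets (P \<alpha> x)" "?C \<beta> \<in> sets (P \<alpha> x)" "?D \<beta> \<in> sets (P \<gamma> 0)" for \<beta> \<gamma>
    using sets_state(1) t ts by blast+
  have [measurable]: "\<xi> t \<in> borel_measurable (P \<alpha> x)" "\<xi> (t + s) \<in> borel_measurable (P \<alpha> x)"
    "\<xi> s \<in> borel_measurable (P \<beta> 0)" for \<beta>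
    using measurable_path(2) t ts by blast+
  have law: "distr (density (P \<alpha> x) (indicator (?A \<beta> \<inter> ?C \<gamma>))) (borel \<Otimes>\<^sub>M borel) (\<lambda>\<omega>. (\<xi> t \<omega>, \<xi> (t + s) \<omega> - \<xi> t \<omega>))
    = distr (density (P \<alpha> x) (indicator (?A \<beta>))) borel (\<xi> t)
      \<Otimes>\<^sub>M distr (density (P \<beta> 0) (indicator (?D \<gamma>))) borel (\<xi> s)" (is "?L = ?M1 \<Otimes>\<^sub>M ?M2") for \<beta> \<gamma>
  proof (rule pair_measure_eqI[symmetric])
    interpret b: prob_space "P \<beta> 0" by (rule prob_space)
    have e1: "emeasure ?M1 B = emeasure (P \<alpha> x) (?A \<beta> \<inter> {\<omega> \<in> \<Omega>. \<xi> t \<omega> \<in> B})" if "B \<in> sets borel" for B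
      using emeasure_distr_density_indicator[of "?A \<beta>" "P \<alpha> x" "\<xi> t" borel B 1] that
      by (auto simp: space_P intro!: arg_cong[where f="emeasure (P \<alpha> x)"])
    have e2: "emeasure ?M2 B = emeasure (P \<beta> 0) {\<omega> \<in> \<Omega>. J s \<omega> = \<gamma> \<and> \<xi> s \<omega> \<in> B}" if "B \<in> sets borel" for B
      using emeasure_distr_density_indicator[of "?D \<gamma>" "P \<beta> 0" "\<xi> s" borel B 1] that
      by (auto simp: space_P intro!: arg_cong[where f="emeasure (P \<beta> 0)"])
    have "finite_measure ?M1" "finite_measure ?M2"
      using e1[of UNIV] e2[of UNIV] by (auto intro!: finite_measureI)
    then show "sigma_finite_measure ?M1" "sigma_finite_measure ?M2"
      by (simp_all add: finite_measure.axioms)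
    show "sets (?M1 \<Otimes>\<^sub>M ?M2) = sets ?L"
      by (simp cong: sets_pair_measure_cong)
    fix A B assume "A \<in> sets ?M1" "B \<in> sets ?M2"
    then have [measurable]: "A \<in> sets borel" "B \<in> sets borel" by auto
    let ?S = "?A \<beta> \<inter> {\<omega> \<in> \<Omega>. \<xi> t \<omega> \<in> A}"
    have "{\<omega> \<in> \<Omega>. \<xi> t \<omega> \<in> A} \<in> sets (F t)"
      using measurable_sets[OF adapted_xi[OF t], of A] subalgebra_F[OF t, of \<alpha> x]
      by (simp add: vimage_def Int_def conj_commute subalgebra_def space_P)
    then have S: "?S \<in> sets (F t)" using sets_state(2)[OF t] by auto
    have "emeasure ?L (A \<times> B) = emeasure (P \<alpha> x) ((?A \<beta> \<inter> ?C \<gamma>) \<inter> ((\<lambda>\<omega>. (\<xi> t \<omega>, \<xi> (t + s) \<omega> - \<xi> t \<omega>)) -` (A \<times> B) \<inter> space (P \<alpha> x)))"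
      using emeasure_distr_density_indicator[of "?A \<beta> \<inter> ?C \<gamma>" "P \<alpha> x" "\<lambda>\<omega>. (\<xi> t \<omega>, \<xi> (t + s) \<omega> - \<xi> t \<omega>)" "borel \<Otimes>\<^sub>M borel" "A \<times> B" 1]
      by simp
    also have "\<dots> = emeasure (P \<alpha> x) (?S \<inter> {\<omega> \<in> \<Omega>. J (t + s) \<omega> = \<gamma> \<and> \<xi> (t + s) \<omega> - \<xi> t \<omega> \<in> B})"
      by (rule arg_cong[where f="emeasure (P \<alpha> x)"]) (auto simp: space_P)
    also have "\<dots> = emeasure ?M1 A * emeasure ?M2 B"
      using increment_law[OF t s S, of \<beta> B \<alpha> x \<gamma>] by (simp add: e1 e2)
    finally show "emeasure ?M1 A * emeasure ?M2 B = emeasure ?L (A \<times> B)" by simp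
  qed
  have step: "(\<integral>\<^sup>+\<omega>. indicator (?A \<beta> \<inter> ?C \<gamma>) \<omega> * (v \<beta> (\<xi> t \<omega>) * w \<gamma> (\<xi> (t + s) \<omega>)) \<partial>P \<alpha> x)
    = (\<integral>\<^sup>+\<omega>. indicator (?A \<beta>) \<omega> * (v \<beta> (\<xi> t \<omega>) * (\<integral>\<^sup>+\<omega>'. indicator (?D \<gamma>) \<omega>' * w \<gamma> (\<xi> s \<omega>' + \<xi> t \<omega>) \<partial>P \<beta> 0)) \<partial>P \<alpha> x)"
    for \<beta> \<gamma>
  proof -
    interpret b: prob_space "P \<beta> 0" by (rule prob_space)
    let ?M1 = "distr (density (P \<alpha> x) (indicator (?A \<beta>))) borel (\<xi> t)"
      and ?M2 = "distr (density (P \<beta> 0) (indicator (?D \<gamma>))) borel (\<xi> s)"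
    have "emeasure ?M2 (space ?M2) < \<infinity>"
      using emeasure_distr_density_indicator[of "?D \<gamma>" "P \<beta> 0" "\<xi> s" borel UNIV 1] by (simp add: less_top[symmetric])
    then interpret M2: finite_measure ?M2 by (intro finite_measureI) auto
    have "(\<integral>\<^sup>+\<omega>. indicator (?A \<beta> \<inter> ?C \<gamma>) \<omega> * (v \<beta> (\<xi> t \<omega>) * w \<gamma> (\<xi> (t + s) \<omega>)) \<partial>P \<alpha> x)
      = (\<integral>\<^sup>+p. v \<beta> (fst p) * w \<gamma> (snd p + fst p) \<partial>distr (density (P \<alpha> x) (indicator (?A \<beta> \<inter> ?C \<gamma>))) (borel \<Otimes>\<^sub>M borel) (\<lambda>\<omega>. (\<xi> t \<omega>, \<xi> (t + s) \<omega> - \<xi> t \<omega>)))"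
      by (subst nn_integral_distr_density_indicator) auto
    also have "\<dots> = (\<integral>\<^sup>+p. v \<beta> (fst p) * w \<gamma> (snd p + fst p) \<partial>(?M1 \<Otimes>\<^sub>M ?M2))"
      by (simp only: law)
    also have "\<dots> = (\<integral>\<^sup>+a. (\<integral>\<^sup>+b. v \<beta> a * w \<gamma> (b + a) \<partial>?M2) \<partial>?M1)"
      by (subst M2.nn_integral_fst[symmetric]) auto
    also have "\<dots> = (\<integral>\<^sup>+a. v \<beta> a * (\<integral>\<^sup>+\<omega>'. indicator (?D \<gamma>) \<omega>' * w \<gamma> (\<xi> s \<omega>' + a) \<partial>P \<beta> 0) \<partial>?M1)"
      by (simp add: nn_integral_cmult nn_integral_distr_density_indicator)
    also have "\<dots> = (\<integral>\<^sup>+\<omega>. indicator (?A \<beta>) \<omega> * (v \<beta> (\<xi> t \<omega>) * (\<integral>\<^sup>+\<omega>'. indicator (?D \<gamma>) \<omega>' * w \<gamma> (\<xi> s \<omega>' + \<xi> t \<omega>) \<partial>P \<beta> 0)) \<partial>P \<alpha> x)"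
      by (subst nn_integral_distr_density_indicator) auto
    finally show ?thesis .
  qed
  have pick: "(\<Sum>\<beta>\<in>UNIV. indicator {\<omega> \<in> \<Omega>. j \<omega> = \<beta>} \<omega> * u \<beta>) = (u (j \<omega>) :: ennreal)"
    if "\<omega> \<in> \<Omega>" for j :: "'a \<Rightarrow> 'e" and u \<omega>
  proof -
    have "(\<Sum>\<beta>\<in>UNIV. indicator {\<omega> \<in> \<Omega>. j \<omega> = \<beta>} \<omega> * u \<beta>) = (\<Sum>\<beta>\<in>UNIV. if \<beta> = j \<omega> then u \<beta> else 0)"
      by (intro sum.cong) (use that in \<open>auto simp: indicator_def\<close>)
    then show ?thesis by simp
  qed
  have "(\<integral>\<^sup>+\<omega>. v (J t \<omega>) (\<xi> t \<omega>) * w (J (t + s) \<omega>) (\<xi> (t + s) \<omega>) \<partial>P \<alpha> x)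
    = (\<integral>\<^sup>+\<omega>. (\<Sum>\<beta>\<in>UNIV. \<Sum>\<gamma>\<in>UNIV. indicator (?A \<beta> \<inter> ?C \<gamma>) \<omega> * (v \<beta> (\<xi> t \<omega>) * w \<gamma> (\<xi> (t + s) \<omega>))) \<partial>P \<alpha> x)"
  proof (rule nn_integral_cong)
    fix \<omega> assume "\<omega> \<in> space (P \<alpha> x)"
    then have o: "\<omega> \<in> \<Omega>" by (simp add: space_P)
    have "(\<Sum>\<beta>\<in>UNIV. \<Sum>\<gamma>\<in>UNIV. indicator (?A \<beta> \<inter> ?C \<gamma>) \<omega> * (v \<beta> (\<xi> t \<omega>) * w \<gamma> (\<xi> (t + s) \<omega>)))
      = (\<Sum>\<beta>\<in>UNIV. indicator (?A \<beta>) \<omega> * (\<Sum>\<gamma>\<in>UNIV. indicator (?C \<gamma>) \<omega> * (v \<beta> (\<xi> t \<omega>) * w \<gamma> (\<xi> (t + s) \<omega>))))"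
      by (simp only: sum_distrib_left indicator_inter_arith mult.assoc)
    also have "\<dots> = v (J t \<omega>) (\<xi> t \<omega>) * w (J (t + s) \<omega>) (\<xi> (t + s) \<omega>)"
      by (simp only: pick[OF o])
    finally show "v (J t \<omega>) (\<xi> t \<omega>) * w (J (t + s) \<omega>) (\<xi> (t + s) \<omega>)
      = (\<Sum>\<beta>\<in>UNIV. \<Sum>\<gamma>\<in>UNIV. indicator (?A \<beta> \<inter> ?C \<gamma>) \<omega> * (v \<beta> (\<xi> t \<omega>) * w \<gamma> (\<xi> (t + s) \<omega>)))" by simp
  qed
  also have "\<dots> = (\<Sum>\<beta>\<in>UNIV. \<Sum>\<gamma>\<in>UNIV. \<integral>\<^sup>+\<omega>. indicator (?A \<beta> \<inter> ?C \<gamma>) \<omega> * (v \<beta> (\<xi> t \<omega>) * w \<gamma> (\<xi> (t + s) \<omega>)) \<partial>P \<alpha> x)"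
    by (subst nn_integral_sum, measurable, subst nn_integral_sum) auto
  also have "\<dots> = (\<Sum>\<beta>\<in>UNIV. \<Sum>\<gamma>\<in>UNIV. (\<integral>\<^sup>+\<omega>. indicator (?A \<beta>) \<omega> * (v \<beta> (\<xi> t \<omega>) * (\<integral>\<^sup>+\<omega>'. indicator (?D \<gamma>) \<omega>' * w \<gamma> (\<xi> s \<omega>' + \<xi> t \<omega>) \<partial>P \<beta> 0)) \<partial>P \<alpha> x))"
    by (simp only: step)
  also have "\<dots> = (\<Sum>\<beta>\<in>UNIV. (\<integral>\<^sup>+\<omega>. indicator (?A \<beta>) \<omega> * (v \<beta> (\<xi> t \<omega>) * transition s w \<beta> (\<xi> t \<omega>)) \<partial>P \<alpha> x))"
  proof (rule sum.cong[OF refl])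
    fix \<beta>
    interpret b: prob_space "P \<beta> 0" by (rule prob_space)
    have tr: "(\<Sum>\<gamma>\<in>UNIV. \<integral>\<^sup>+\<omega>'. indicator (?D \<gamma>) \<omega>' * w \<gamma> (\<xi> s \<omega>' + z) \<partial>P \<beta> 0) = transition s w \<beta> z" for z
    proof -
      have "(\<Sum>\<gamma>\<in>UNIV. \<integral>\<^sup>+\<omega>'. indicator (?D \<gamma>) \<omega>' * w \<gamma> (\<xi> s \<omega>' + z) \<partial>P \<beta> 0)
        = (\<integral>\<^sup>+\<omega>'. (\<Sum>\<gamma>\<in>UNIV. indicator (?D \<gamma>) \<omega>' * w \<gamma> (\<xi> s \<omega>' + z)) \<partial>P \<beta> 0)"
        by (subst nn_integral_sum) auto
      also have "\<dots> = transition s w \<beta> z"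
        unfolding transition_def by (intro nn_integral_cong pick) (simp add: space_P)
      finally show ?thesis .
    qed
    show "(\<Sum>\<gamma>\<in>UNIV. (\<integral>\<^sup>+\<omega>. indicator (?A \<beta>) \<omega> * (v \<beta> (\<xi> t \<omega>) * (\<integral>\<^sup>+\<omega>'. indicator (?D \<gamma>) \<omega>' * w \<gamma> (\<xi> s \<omega>' + \<xi> t \<omega>) \<partial>P \<beta> 0)) \<partial>P \<alpha> x))
      = (\<integral>\<^sup>+\<omega>. indicator (?A \<beta>) \<omega> * (v \<beta> (\<xi> t \<omega>) * transition s w \<beta> (\<xi> t \<omega>)) \<partial>P \<alpha> x)"
      by (subst nn_integral_sum[symmetric]) (auto simp: sum_distrib_left[symmetric] tr)
  qed
  also have "\<dots> = (\<integral>\<^sup>+\<omega>. v (J t \<omega>) (\<xi> t \<omega>) * transition s w (J t \<omega>) (\<xi> t \<omega>) \<partial>P \<alpha> x)"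
  proof -
    have [measurable]: "transition s w \<beta> \<in> borel_measurable borel" for \<beta>
    proof -
      interpret b: prob_space "P \<beta> 0" by (rule prob_space)
      show ?thesis unfolding transition_def
        by (intro b.borel_measurable_nn_integral, unfold case_prod_unfold, rule measurable_state[where w=w])
          (auto intro!: measurable_compose[OF measurable_snd] measurable_path ts
             simp: borel_measurable_add)
    qed
    show ?thesis
      by (subst nn_integral_sum[symmetric], measurable)
        (auto intro!: nn_integral_cong simp: pick space_P)
  qed
  finally show ?thesis .
qed

lemma measurable_transition:
  assumes w: "\<And>\<beta>. w \<beta> \<in> borel_measurable borel"
  shows "(\<lambda>p. transition (max 0 (fst p)) w \<beta> (snd p)) \<in> borel_measurable (borel \<Otimes>\<^sub>M borel)"
proof -
  interpret b: prob_space "P \<beta> 0" by (rule prob_space)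
  have m: "(\<lambda>q. (fst (fst q), snd q)) \<in> (borel \<Otimes>\<^sub>M borel) \<Otimes>\<^sub>M P \<beta> 0 \<rightarrow>\<^sub>M borel \<Otimes>\<^sub>M P \<beta> 0"
    by measurable
  show ?thesis
    unfolding transition_def
  proof (rule b.borel_measurable_nn_integral, unfold case_prod_unfold, rule measurable_state[where w=w])
    show "(\<lambda>q. J (max 0 (fst (fst q))) (snd q)) \<in> (borel \<Otimes>\<^sub>M borel) \<Otimes>\<^sub>M P \<beta> 0 \<rightarrow>\<^sub>M count_space UNIV"
      using measurable_compose[OF m measurable_joint(2)] by simp
    have "(\<lambda>q. \<xi> (max 0 (fst (fst q))) (snd q)) \<in> borel_measurable ((borel \<Otimes>\<^sub>M borel) \<Otimes>\<^sub>M P \<beta> 0)"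
      using measurable_compose[OF m measurable_joint(1)] by simp
    then show "(\<lambda>q. \<xi> (max 0 (fst (fst q))) (snd q) + snd (fst q)) \<in> borel_measurable ((borel \<Otimes>\<^sub>M borel) \<Otimes>\<^sub>M P \<beta> 0)"
      by measurable
  qed (rule w)
qed

lemma transition_0:
  assumes w: "\<And>\<beta>. w \<beta> \<in> borel_measurable borel"
  shows "transition 0 w \<beta> z = w \<beta> z"
proof -
  interpret b: prob_space "P \<beta> 0" by (rule prob_space)
  have "transition 0 w \<beta> z = (\<integral>\<^sup>+\<omega>. w \<beta> z \<partial>P \<beta> 0)"
    unfolding transition_def
  proof (rule nn_integral_cong_AE)
    show "AE \<omega> in P \<beta> 0. w (J 0 \<omega>) (\<xi> 0 \<omega> + z) = w \<beta> z"
      using start[of \<beta> 0] by eventually_elim simp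
  qed
  then show ?thesis by (simp add: b.emeasure_space_1)
qed

lemma markov:
  assumes t: "0 \<le> t" and s: "0 \<le> s"
    and v: "\<And>\<beta>. v \<beta> \<in> borel_measurable borel"
    and w: "\<And>\<beta>. w \<beta> \<in> borel_measurable borel"
  shows "(\<integral>\<^sup>+\<omega>. v (J t \<omega>) (\<xi> t \<omega>) * w (J (t + s) \<omega>) (\<xi> (t + s) \<omega>) \<partial>P \<alpha> x)
       = (\<integral>\<^sup>+\<omega>. v (J t \<omega>) (\<xi> t \<omega>) * transition s w (J t \<omega>) (\<xi> t \<omega>) \<partial>P \<alpha> x)"
  using markov_positive_lag[where v=v and w=w, OF t _ v w] s by (cases "s = 0") (auto simp: transition_0[of w, OF w])

lemma nn_integral_state:
  assumes s: "0 \<le> s" and w: "\<And>\<beta>. w \<beta> \<in> borel_measurable borel"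
  shows "(\<integral>\<^sup>+\<omega>. w (J s \<omega>) (\<xi> s \<omega>) \<partial>P \<alpha> x) = transition s w \<alpha> x"
proof -
  interpret a: prob_space "P \<alpha> x" by (rule prob_space)
  have "(\<integral>\<^sup>+\<omega>. w (J s \<omega>) (\<xi> s \<omega>) \<partial>P \<alpha> x) = (\<integral>\<^sup>+\<omega>. transition s w (J 0 \<omega>) (\<xi> 0 \<omega>) \<partial>P \<alpha> x)"
    using markov[where v="\<lambda>_ _. 1" and w=w, OF order_refl s _ w] by simp
  also have "\<dots> = (\<integral>\<^sup>+\<omega>. transition s w \<alpha> x \<partial>P \<alpha> x)"
    by (rule nn_integral_cong_AE) (use start[of \<alpha> x] in \<open>eventually_elim, simp\<close>)
  finally show ?thesis by (simp add: a.emeasure_space_1)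
qed

lemma measurable_path_pair:
  assumes w: "\<And>\<beta>. w \<beta> \<in> borel_measurable borel"
  shows "(\<lambda>p. w (Jp (fst p) (snd p)) (Xp (fst p) (snd p))) \<in> borel_measurable (borel \<Otimes>\<^sub>M P \<alpha> x)"
  by (rule measurable_state[where w=w, OF measurable_joint(2,1) w])

lemma measurable_path_state:
  assumes t: "0 \<le> t" and w: "\<And>\<beta>. w \<beta> \<in> borel_measurable borel"
  shows "(\<lambda>\<omega>. w (J t \<omega>) (\<xi> t \<omega>)) \<in> borel_measurable (P \<alpha> x)"
  by (rule measurable_state[where w=w, OF measurable_path[OF t] w])

end

section \<open>Functions with vanishing potential\<close>

context markov_additive_process
begin

text \<open>
The expected integral of \<open>w\<close> along the path up to time \<open>T\<close>, that is, the potential of \<open>w\<close> for the process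
killed at time \<open>T\<close>.
\<close>

definition potential :: "real \<Rightarrow> ('e \<Rightarrow> real \<Rightarrow> ennreal) \<Rightarrow> 'e \<Rightarrow> real \<Rightarrow> ennreal" where
  "potential T w \<beta> z = (\<integral>\<^sup>+u. (\<integral>\<^sup>+\<omega>. w (Jp u \<omega>) (Xp u \<omega>) \<partial>P \<beta> z) * indicator {0..<T} u \<partial>lborel)"

text \<open>
Only the potential of \<open>w\<close> at the state at time \<open>s\<close> matters for the future of \<open>w\<close> after \<open>s\<close>. This is the
point at which equality of two potentials from every starting point is turned into equality of
the correlations with functions of an earlier state.
\<close>

lemma potential_markov:
  assumes s: "0 \<le> s"
    and v: "\<And>\<beta>. v \<beta> \<in> borel_measurable borel"
    and w: "\<And>\<beta>. w \<beta> \<in> borel_measurable borel"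
  shows "(\<integral>\<^sup>+u. (\<integral>\<^sup>+\<omega>. v (J s \<omega>) (\<xi> s \<omega>) * w (Jp u \<omega>) (Xp u \<omega>) \<partial>P \<alpha> x) * indicator {s..<s + T} u \<partial>lborel)
    = (\<integral>\<^sup>+\<omega>. v (J s \<omega>) (\<xi> s \<omega>) * potential T w (J s \<omega>) (\<xi> s \<omega>) \<partial>P \<alpha> x)"
proof -
  interpret a: prob_space "P \<alpha> x" by (rule prob_space)
  interpret pair_sigma_finite lborel "P \<alpha> x" ..
  note vs = measurable_path_state[where w=v, OF s v, of \<alpha> x]
  have vs': "(\<lambda>p. v (J s (snd p)) (\<xi> s (snd p))) \<in> borel_measurable (borel \<Otimes>\<^sub>M P \<alpha> x)"
    by (rule measurable_compose[OF measurable_snd vs])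
  have vw: "(\<lambda>p. v (J s (snd p)) (\<xi> s (snd p)) * w (Jp (fst p) (snd p)) (Xp (fst p) (snd p)))
     \<in> borel_measurable (borel \<Otimes>\<^sub>M P \<alpha> x)"
    using vs' measurable_path_pair[where w=w, OF w] by (rule borel_measurable_times_ennreal)
  have inner: "(\<lambda>u. \<integral>\<^sup>+\<omega>. v (J s \<omega>) (\<xi> s \<omega>) * w (Jp u \<omega>) (Xp u \<omega>) \<partial>P \<alpha> x) \<in> borel_measurable borel"
    by (rule a.borel_measurable_nn_integral, unfold case_prod_unfold, rule vw)
  have tr: "(\<lambda>p. transition (max 0 (fst p)) w (J s (snd p)) (\<xi> s (snd p))) \<in> borel_measurable (borel \<Otimes>\<^sub>M P \<alpha> x)"
  proof (rule measurable_compose_countable[where g="\<lambda>p. J s (snd p)"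
        and f="\<lambda>\<beta> p. transition (max 0 (fst p)) w \<beta> (\<xi> s (snd p))"])
    show "(\<lambda>p. J s (snd p)) \<in> borel \<Otimes>\<^sub>M P \<alpha> x \<rightarrow>\<^sub>M count_space UNIV"
      by (rule measurable_compose[OF measurable_snd measurable_path(1)[OF s]])
    fix \<beta>
    have "(\<lambda>p. (fst p, \<xi> s (snd p))) \<in> borel \<Otimes>\<^sub>M P \<alpha> x \<rightarrow>\<^sub>M borel \<Otimes>\<^sub>M borel"
      using measurable_compose[OF measurable_snd measurable_path(2)[OF s]] by (intro measurable_Pair) auto
    from measurable_compose[OF this measurable_transition[where w=w and \<beta>=\<beta>, OF w]]
    show "(\<lambda>p. transition (max 0 (fst p)) w \<beta> (\<xi> s (snd p))) \<in> borel_measurable (borel \<Otimes>\<^sub>M P \<alpha> x)"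
      by simp
  qed
  have tr1: "(\<lambda>\<omega>. transition (max 0 u) w (J s \<omega>) (\<xi> s \<omega>)) \<in> borel_measurable (P \<alpha> x)" for u
    using measurable_compose[OF measurable_Pair1' tr, of u] by (simp add: space_pair_measure)
  have "(\<integral>\<^sup>+u. (\<integral>\<^sup>+\<omega>. v (J s \<omega>) (\<xi> s \<omega>) * w (Jp u \<omega>) (Xp u \<omega>) \<partial>P \<alpha> x) * indicator {s..<s + T} u \<partial>lborel)
    = (\<integral>\<^sup>+u. (\<integral>\<^sup>+\<omega>. v (J s \<omega>) (\<xi> s \<omega>) * w (Jp (s + u) \<omega>) (Xp (s + u) \<omega>) \<partial>P \<alpha> x) * indicator {s..<s + T} (s + u) \<partial>lborel)"
    by (subst nn_integral_real_affine[where c=1 and t=s])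
      (intro borel_measurable_times_ennreal inner borel_measurable_indicator, simp_all)
  also have "\<dots> = (\<integral>\<^sup>+u. (\<integral>\<^sup>+\<omega>. (v (J s \<omega>) (\<xi> s \<omega>) * transition (max 0 u) w (J s \<omega>) (\<xi> s \<omega>)) * indicator {0..<T} u \<partial>P \<alpha> x) \<partial>lborel)"
  proof (rule nn_integral_cong)
    fix u :: real
    show "(\<integral>\<^sup>+\<omega>. v (J s \<omega>) (\<xi> s \<omega>) * w (Jp (s + u) \<omega>) (Xp (s + u) \<omega>) \<partial>P \<alpha> x) * indicator {s..<s + T} (s + u)
      = (\<integral>\<^sup>+\<omega>. (v (J s \<omega>) (\<xi> s \<omega>) * transition (max 0 u) w (J s \<omega>) (\<xi> s \<omega>)) * indicator {0..<T} u \<partial>P \<alpha> x)"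
    proof (cases "u \<in> {0..<T}")
      case True
      then show ?thesis using markov[where v=v and w=w, OF s _ v w, of u] s by simp
    qed (auto simp: indicator_def)
  qed
  also have "\<dots> = (\<integral>\<^sup>+\<omega>. (\<integral>\<^sup>+u. (v (J s \<omega>) (\<xi> s \<omega>) * transition (max 0 u) w (J s \<omega>) (\<xi> s \<omega>)) * indicator {0..<T} u \<partial>lborel) \<partial>P \<alpha> x)"
  proof (rule Fubini'[symmetric])
    have "(\<lambda>p. v (J s (snd p)) (\<xi> s (snd p)) * transition (max 0 (fst p)) w (J s (snd p)) (\<xi> s (snd p)) * indicator {0..<T} (fst p)) \<in> borel_measurable (borel \<Otimes>\<^sub>M P \<alpha> x)"
      by (intro borel_measurable_times_ennreal vs' tr borel_measurable_indicator'
          measurable_compose[OF measurable_fst]) simp_all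
    then show "(\<lambda>(u, \<omega>). v (J s \<omega>) (\<xi> s \<omega>) * transition (max 0 u) w (J s \<omega>) (\<xi> s \<omega>) * indicator {0..<T} u) \<in> borel_measurable (lborel \<Otimes>\<^sub>M P \<alpha> x)"
      by (simp add: case_prod_unfold)
  qed
  also have "\<dots> = (\<integral>\<^sup>+\<omega>. v (J s \<omega>) (\<xi> s \<omega>) * potential T w (J s \<omega>) (\<xi> s \<omega>) \<partial>P \<alpha> x)"
  proof (rule nn_integral_cong)
    fix \<omega> assume "\<omega> \<in> space (P \<alpha> x)"
    have [measurable]: "(\<lambda>u. transition (max 0 u) w \<beta> z) \<in> borel_measurable borel" for \<beta> z
      using measurable_compose[OF measurable_Pair2' measurable_transition[where w=w, OF w], of z] by simp
    show "(\<integral>\<^sup>+u. (v (J s \<omega>) (\<xi> s \<omega>) * transition (max 0 u) w (J s \<omega>) (\<xi> s \<omega>)) * indicator {0..<T} u \<partial>lborel)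
      = v (J s \<omega>) (\<xi> s \<omega>) * potential T w (J s \<omega>) (\<xi> s \<omega>)"
      unfolding potential_def by (simp add: nn_integral_state[where w=w, OF _ w] mult.assoc nn_integral_cmult)
  qed
  finally show ?thesis .
qed

lemma measurable_two_times:
  assumes s: "0 \<le> s"
    and v: "\<And>\<beta>. v \<beta> \<in> borel_measurable borel" and w: "\<And>\<beta>. w \<beta> \<in> borel_measurable borel"
  shows "(\<lambda>u. \<integral>\<^sup>+\<omega>. v (J s \<omega>) (\<xi> s \<omega>) * w (Jp u \<omega>) (Xp u \<omega>) \<partial>P \<alpha> x) \<in> borel_measurable borel"
proof -
  interpret a: prob_space "P \<alpha> x" by (rule prob_space)
  have "(\<lambda>p. v (J s (snd p)) (\<xi> s (snd p))) \<in> borel_measurable (borel \<Otimes>\<^sub>M P \<alpha> x)"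
    by (rule measurable_compose[OF measurable_snd measurable_path_state[where w=v, OF s v]])
  then have vw: "(\<lambda>p. v (J s (snd p)) (\<xi> s (snd p)) * w (Jp (fst p) (snd p)) (Xp (fst p) (snd p)))
     \<in> borel_measurable (borel \<Otimes>\<^sub>M P \<alpha> x)"
    using measurable_path_pair[where w=w, OF w] by (rule borel_measurable_times_ennreal)
  show ?thesis
    by (rule a.borel_measurable_nn_integral, unfold case_prod_unfold, rule vw)
qed

lemma grid_potential:
  assumes v: "\<And>\<beta>. v \<beta> \<in> borel_measurable borel" and w: "\<And>\<beta>. w \<beta> \<in> borel_measurable borel"
  shows "(\<integral>\<^sup>+u. (\<integral>\<^sup>+\<omega>. v (Jp (grid n u) \<omega>) (Xp (grid n u) \<omega>) * w (Jp u \<omega>) (Xp u \<omega>) \<partial>P \<alpha> x) * indicator {0..<1} u \<partial>lborel)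
    = (\<Sum>i<Suc n. \<integral>\<^sup>+\<omega>. v (J (real i / real (Suc n)) \<omega>) (\<xi> (real i / real (Suc n)) \<omega>) *
         potential (1 / real (Suc n)) w (J (real i / real (Suc n)) \<omega>) (\<xi> (real i / real (Suc n)) \<omega>) \<partial>P \<alpha> x)"
proof -
  define f where "f s u = (\<integral>\<^sup>+\<omega>. v (Jp s \<omega>) (Xp s \<omega>) * w (Jp u \<omega>) (Xp u \<omega>) \<partial>P \<alpha> x)" for s u
  have fm: "f s \<in> borel_measurable borel" for s
    unfolding f_def by (rule measurable_two_times[where v=v and w=w, OF _ v w]) simp
  have "(\<integral>\<^sup>+u. f (grid n u) u * indicator {0..<1} u \<partial>lborel)
    = (\<integral>\<^sup>+u. (\<Sum>i<Suc n. f (real i / real (Suc n)) u * indicator {real i / real (Suc n)..<real i / real (Suc n) + 1 / real (Suc n)} u) \<partial>lborel)"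
    by (simp only: grid_decomposition)
  also have "\<dots> = (\<Sum>i<Suc n. \<integral>\<^sup>+u. f (real i / real (Suc n)) u * indicator {real i / real (Suc n)..<real i / real (Suc n) + 1 / real (Suc n)} u \<partial>lborel)"
    by (rule nn_integral_sum) (intro borel_measurable_times_ennreal, simp_all add: fm)
  also have "\<dots> = (\<Sum>i<Suc n. \<integral>\<^sup>+\<omega>. v (J (real i / real (Suc n)) \<omega>) (\<xi> (real i / real (Suc n)) \<omega>) *
         potential (1 / real (Suc n)) w (J (real i / real (Suc n)) \<omega>) (\<xi> (real i / real (Suc n)) \<omega>) \<partial>P \<alpha> x)"
  proof (rule sum.cong[OF refl])
    fix i
    have p: "0 \<le> real i / real (Suc n)" by simp
    then have "max 0 (real i / real (Suc n)) = real i / real (Suc n)" by (rule max_absorb2)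
    then show "(\<integral>\<^sup>+u. f (real i / real (Suc n)) u * indicator {real i / real (Suc n)..<real i / real (Suc n) + 1 / real (Suc n)} u \<partial>lborel)
      = (\<integral>\<^sup>+\<omega>. v (J (real i / real (Suc n)) \<omega>) (\<xi> (real i / real (Suc n)) \<omega>) *
         potential (1 / real (Suc n)) w (J (real i / real (Suc n)) \<omega>) (\<xi> (real i / real (Suc n)) \<omega>) \<partial>P \<alpha> x)"
      unfolding f_def using potential_markov[where v=v and w=w, OF p v w, of \<alpha> x "1 / real (Suc n)"] by (simp only:)
  qed
  finally show ?thesis unfolding f_def .
qed

lemma path_left_limit:
  assumes v: "\<And>\<beta>. continuous_on UNIV (v \<beta>)" and w: "\<omega> \<in> \<Omega>" and u: "0 < u"
  shows "\<exists>L::real. ((\<lambda>s. v (Jp s \<omega>) (Xp s \<omega>)) \<longlongrightarrow> L) (at_left u)"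
proof -
  obtain \<beta> where b: "\<forall>\<^sub>F s in at_left u. J s \<omega> = \<beta>" using J_left[OF w u] by blast
  obtain l where l: "((\<lambda>s. \<xi> s \<omega>) \<longlongrightarrow> l) (at_left u)" using xi_left[OF w u] by blast
  have pos: "\<forall>\<^sub>F s in at_left u. 0 < s"
    using u by (auto simp: eventually_at_left_field)
  have "((\<lambda>s. v \<beta> (\<xi> s \<omega>)) \<longlongrightarrow> v \<beta> l) (at_left u)"
    by (rule continuous_on_tendsto_compose[OF v l]) simp_all
  moreover have "\<forall>\<^sub>F s in at_left u. v \<beta> (\<xi> s \<omega>) = v (Jp s \<omega>) (Xp s \<omega>)"
    using b pos by eventually_elim simp
  ultimately have "((\<lambda>s. v (Jp s \<omega>) (Xp s \<omega>)) \<longlongrightarrow> v \<beta> l) (at_left u)"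
    by (rule Lim_transform_eventually)
  then show ?thesis by blast
qed

lemma path_right_limit:
  assumes v: "\<And>\<beta>. continuous_on UNIV (v \<beta>)" and w: "\<omega> \<in> \<Omega>" and u: "0 \<le> u"
  shows "((\<lambda>s. v (Jp s \<omega>) (Xp s \<omega>)) \<longlongrightarrow> (v (J u \<omega>) (\<xi> u \<omega>) :: real)) (at_right u)"
proof -
  have pos: "\<forall>\<^sub>F s in at_right u. u < s"
    by (simp add: eventually_at_right_less)
  have "((\<lambda>s. v (J u \<omega>) (\<xi> s \<omega>)) \<longlongrightarrow> v (J u \<omega>) (\<xi> u \<omega>)) (at_right u)"
    by (rule continuous_on_tendsto_compose[OF v xi_right[OF w u]]) simp_all
  moreover have "\<forall>\<^sub>F s in at_right u. v (J u \<omega>) (\<xi> s \<omega>) = v (Jp s \<omega>) (Xp s \<omega>)"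
    using J_right[OF w u] pos by eventually_elim (use u in simp)
  ultimately show ?thesis by (rule Lim_transform_eventually)
qed

text \<open>
The factor \<open>v\<close> is bounded and converges along almost every time, while \<open>h\<close> stays fixed and has finite
potential. Dominated convergence thus applies, once in time for a fixed path and
once over the paths.
\<close>

lemma grid_limit:
  fixes v h :: "'e \<Rightarrow> real \<Rightarrow> real"
  assumes v: "\<And>\<beta>. continuous_on UNIV (v \<beta>)" "\<And>\<beta> z. 0 \<le> v \<beta> z" "\<And>\<beta> z. v \<beta> z \<le> 1"
    and h: "\<And>\<beta>. h \<beta> \<in> borel_measurable borel"
    and fin: "potential 1 (\<lambda>\<beta> z. ennreal (h \<beta> z)) \<alpha> x < \<infinity>"
  shows "(\<lambda>n. \<integral>\<^sup>+u. (\<integral>\<^sup>+\<omega>. ennreal (v (Jp (grid n u) \<omega>) (Xp (grid n u) \<omega>)) * ennreal (h (Jp u \<omega>) (Xp u \<omega>)) \<partial>P \<alpha> x) * indicator {0..<1} u \<partial>lborel)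
    \<longlonglongrightarrow> (\<integral>\<^sup>+\<omega>. (\<integral>\<^sup>+u. ennreal (v (Jp u \<omega>) (Xp u \<omega>) * h (Jp u \<omega>) (Xp u \<omega>)) * indicator {0..<1} u \<partial>lborel) \<partial>P \<alpha> x)"
proof -
  interpret a: prob_space "P \<alpha> x" by (rule prob_space)
  interpret pair_sigma_finite lborel "P \<alpha> x" ..
  have vb: "v \<beta> \<in> borel_measurable borel" for \<beta> using v(1) by (simp add: borel_measurable_continuous_onI)
  have gm: "grid n \<in> borel_measurable borel" for n unfolding grid_def by measurable
  have vm: "(\<lambda>p. v (Jp (fst p) (snd p)) (Xp (fst p) (snd p))) \<in> borel_measurable (borel \<Otimes>\<^sub>M P \<alpha> x)"
    by (rule measurable_path_pair[where w=v, OF vb])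
  have hm: "(\<lambda>p. h (Jp (fst p) (snd p)) (Xp (fst p) (snd p))) \<in> borel_measurable (borel \<Otimes>\<^sub>M P \<alpha> x)"
    by (rule measurable_path_pair[where w=h, OF h])
  have vgm: "(\<lambda>p. v (Jp (grid n (fst p)) (snd p)) (Xp (grid n (fst p)) (snd p))) \<in> borel_measurable (borel \<Otimes>\<^sub>M P \<alpha> x)" for n
  proof -
    have "(\<lambda>p. (grid n (fst p), snd p)) \<in> borel \<Otimes>\<^sub>M P \<alpha> x \<rightarrow>\<^sub>M borel \<Otimes>\<^sub>M P \<alpha> x"
      by (intro measurable_Pair measurable_compose[OF measurable_fst gm] measurable_snd)
    from measurable_compose[OF this vm] show ?thesis by simp
  qed
  define g where "g n \<omega> u = ennreal (v (Jp (grid n u) \<omega>) (Xp (grid n u) \<omega>) * h (Jp u \<omega>) (Xp u \<omega>)) * indicator {0..<1} u" for n \<omega> u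
  define g' where "g' \<omega> u = ennreal (v (Jp u \<omega>) (Xp u \<omega>) * h (Jp u \<omega>) (Xp u \<omega>)) * indicator {0..<1} u" for \<omega> u
  define B where "B \<omega> u = ennreal (h (Jp u \<omega>) (Xp u \<omega>)) * indicator {0..<1::real} u" for \<omega> u
  have gM: "(\<lambda>p. g n (snd p) (fst p)) \<in> borel_measurable (borel \<Otimes>\<^sub>M P \<alpha> x)" for n
    unfolding g_def
    by (intro borel_measurable_times_ennreal measurable_compose[OF borel_measurable_times[OF vgm hm] measurable_ennreal]
        measurable_compose[OF measurable_fst]) simp_all
  have g'M: "(\<lambda>p. g' (snd p) (fst p)) \<in> borel_measurable (borel \<Otimes>\<^sub>M P \<alpha> x)"
    unfolding g'_def
    by (intro borel_measurable_times_ennreal measurable_compose[OF borel_measurable_times[OF vm hm] measurable_ennreal]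
        measurable_compose[OF measurable_fst]) simp_all
  have BM: "(\<lambda>p. B (snd p) (fst p)) \<in> borel_measurable (borel \<Otimes>\<^sub>M P \<alpha> x)"
    unfolding B_def
    by (intro borel_measurable_times_ennreal measurable_compose[OF hm measurable_ennreal]
        measurable_compose[OF measurable_fst]) simp_all
  have outer: "(\<lambda>\<omega>. \<integral>\<^sup>+u. k \<omega> u \<partial>lborel) \<in> borel_measurable (P \<alpha> x)"
    and swap: "(\<integral>\<^sup>+u. (\<integral>\<^sup>+\<omega>. k \<omega> u \<partial>P \<alpha> x) \<partial>lborel) = (\<integral>\<^sup>+\<omega>. (\<integral>\<^sup>+u. k \<omega> u \<partial>lborel) \<partial>P \<alpha> x)"
    and sect: "\<omega> \<in> \<Omega> \<Longrightarrow> (\<lambda>u. k \<omega> u) \<in> borel_measurable lborel"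
    if k: "(\<lambda>p. k (snd p) (fst p)) \<in> borel_measurable (borel \<Otimes>\<^sub>M P \<alpha> x)" for k :: "'a \<Rightarrow> real \<Rightarrow> ennreal" and \<omega>
  proof -
    have "(\<lambda>p. k (fst p) (snd p)) \<in> borel_measurable (P \<alpha> x \<Otimes>\<^sub>M borel)"
      using measurable_compose[OF measurable_pair_swap' k] by (simp add: case_prod_unfold)
    then show "(\<lambda>\<omega>. \<integral>\<^sup>+u. k \<omega> u \<partial>lborel) \<in> borel_measurable (P \<alpha> x)"
      by (intro lborel.borel_measurable_nn_integral) (simp add: case_prod_unfold)
    have "(\<lambda>(u, \<omega>). k \<omega> u) \<in> borel_measurable (lborel \<Otimes>\<^sub>M P \<alpha> x)"
      using k by (simp add: case_prod_unfold)
    then show "(\<integral>\<^sup>+u. (\<integral>\<^sup>+\<omega>. k \<omega> u \<partial>P \<alpha> x) \<partial>lborel) = (\<integral>\<^sup>+\<omega>. (\<integral>\<^sup>+u. k \<omega> u \<partial>lborel) \<partial>P \<alpha> x)"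
      by (rule Fubini'[symmetric])
    show "(\<lambda>u. k \<omega> u) \<in> borel_measurable lborel" if "\<omega> \<in> \<Omega>"
      using measurable_compose[OF measurable_Pair2' k, of \<omega>] that by (simp add: space_P)
  qed
  have le: "g n \<omega> u \<le> B \<omega> u" for n \<omega> u
  proof -
    have "v b y * c \<le> max 0 c" for b y c
      using v(2,3)[of b y] by (cases "0 \<le> c") (auto simp: mult_left_le_one_le mult_nonneg_nonpos)
    then have "ennreal (v b y * c) \<le> ennreal c" for b y c
      by (rule order_trans[OF ennreal_leI]) (simp add: max_def ennreal_neg)
    then show ?thesis unfolding g_def B_def by (intro mult_right_mono) auto
  qed
  have Bfin: "(\<integral>\<^sup>+\<omega>. (\<integral>\<^sup>+u. B \<omega> u \<partial>lborel) \<partial>P \<alpha> x) < \<infinity>"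
  proof -
    have hu: "(\<lambda>\<omega>. ennreal (h (Jp u \<omega>) (Xp u \<omega>))) \<in> borel_measurable (P \<alpha> x)" for u
      by (rule measurable_compose[OF measurable_path_state[where w=h, OF _ h] measurable_ennreal]) simp
    have "(\<integral>\<^sup>+u. (\<integral>\<^sup>+\<omega>. B \<omega> u \<partial>P \<alpha> x) \<partial>lborel) = potential 1 (\<lambda>\<beta> z. ennreal (h \<beta> z)) \<alpha> x"
      unfolding potential_def B_def by (intro nn_integral_cong nn_integral_multc hu)
    then show ?thesis using fin swap[OF BM] by simp
  qed
  have inner: "(\<lambda>n. \<integral>\<^sup>+u. g n \<omega> u \<partial>lborel) \<longlonglongrightarrow> (\<integral>\<^sup>+u. g' \<omega> u \<partial>lborel)"
    if o: "\<omega> \<in> \<Omega>" and f: "(\<integral>\<^sup>+u. B \<omega> u \<partial>lborel) < \<infinity>" for \<omega>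
  proof (rule nn_integral_dominated_convergence[where w="B \<omega>"])
    show "g n \<omega> \<in> borel_measurable lborel" for n using sect[OF gM o] .
    show "g' \<omega> \<in> borel_measurable lborel" using sect[OF g'M o] .
    show "B \<omega> \<in> borel_measurable lborel" using sect[OF BM o] .
    show "AE u in lborel. (\<lambda>n. g n \<omega> u) \<longlonglongrightarrow> g' \<omega> u"
    proof -
      have "AE u in lborel. 0 < u \<longrightarrow> (\<lambda>n. v (Jp (grid n u) \<omega>) (Xp (grid n u) \<omega>)) \<longlonglongrightarrow> v (Jp u \<omega>) (Xp u \<omega>)"
        by (rule AE_LIMSEQ_left[where b="\<lambda>u. v (Jp u \<omega>) (Xp u \<omega>)"])
          (use path_left_limit[where v=v, OF v(1) o] grid_le LIMSEQ_grid in auto)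
      moreover have "AE u in lborel. u \<noteq> (0::real)"
        by (rule AE_lborel_singleton)
      ultimately show ?thesis
      proof eventually_elim
        case (elim u)
        show ?case
        proof (cases "u \<in> {0..<1}")
          case True
          then have "(\<lambda>n. v (Jp (grid n u) \<omega>) (Xp (grid n u) \<omega>)) \<longlonglongrightarrow> v (Jp u \<omega>) (Xp u \<omega>)"
            using elim by auto
          then show ?thesis unfolding g_def g'_def using True
            by (simp del: max.absorb2) (intro tendsto_ennrealI tendsto_mult_right)
        qed (simp add: g_def g'_def)
      qed
    qed
  qed (use le f in auto)
  have "(\<lambda>n. \<integral>\<^sup>+\<omega>. (\<integral>\<^sup>+u. g n \<omega> u \<partial>lborel) \<partial>P \<alpha> x) \<longlonglongrightarrow> (\<integral>\<^sup>+\<omega>. (\<integral>\<^sup>+u. g' \<omega> u \<partial>lborel) \<partial>P \<alpha> x)"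
  proof (rule nn_integral_dominated_convergence[where w="\<lambda>\<omega>. \<integral>\<^sup>+u. B \<omega> u \<partial>lborel"])
    show "AE \<omega> in P \<alpha> x. (\<lambda>n. \<integral>\<^sup>+u. g n \<omega> u \<partial>lborel) \<longlonglongrightarrow> (\<integral>\<^sup>+u. g' \<omega> u \<partial>lborel)"
    proof -
      have "AE \<omega> in P \<alpha> x. (\<integral>\<^sup>+u. B \<omega> u \<partial>lborel) \<noteq> \<infinity>"
        using Bfin by (intro nn_integral_PInf_AE outer[OF BM]) auto
      then show ?thesis
        by (rule AE_mp) (auto intro!: AE_I2 inner simp: space_P less_top)
    qed
    show "AE \<omega> in P \<alpha> x. (\<integral>\<^sup>+u. g n \<omega> u \<partial>lborel) \<le> (\<integral>\<^sup>+u. B \<omega> u \<partial>lborel)" for n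
      by (intro AE_I2 nn_integral_mono le)
  qed (use outer[OF gM] outer[OF g'M] outer[OF BM] Bfin in auto)
  moreover have "(\<integral>\<^sup>+\<omega>. (\<integral>\<^sup>+u. g n \<omega> u \<partial>lborel) \<partial>P \<alpha> x)
    = (\<integral>\<^sup>+u. (\<integral>\<^sup>+\<omega>. ennreal (v (Jp (grid n u) \<omega>) (Xp (grid n u) \<omega>)) * ennreal (h (Jp u \<omega>) (Xp u \<omega>)) \<partial>P \<alpha> x) * indicator {0..<1} u \<partial>lborel)" for n
  proof -
    have "(\<lambda>\<omega>. ennreal (v (Jp (grid n u) \<omega>) (Xp (grid n u) \<omega>) * h (Jp u \<omega>) (Xp u \<omega>))) \<in> borel_measurable (P \<alpha> x)" for u
      by (intro measurable_compose[OF _ measurable_ennreal] borel_measurable_times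
          measurable_path_state[where w=v, OF _ vb] measurable_path_state[where w=h, OF _ h]) simp_all
    then have "(\<integral>\<^sup>+\<omega>. g n \<omega> u \<partial>P \<alpha> x) = (\<integral>\<^sup>+\<omega>. ennreal (v (Jp (grid n u) \<omega>) (Xp (grid n u) \<omega>) * h (Jp u \<omega>) (Xp u \<omega>)) \<partial>P \<alpha> x) * indicator {0..<1} u" for u
      unfolding g_def by (intro nn_integral_multc)
    then show ?thesis
      unfolding swap[OF gM, symmetric] by (simp only: ennreal_mult'[OF v(2)])
  qed
  ultimately show ?thesis unfolding g'_def by simp
qed

text \<open>
With \<open>v = min 1 (max 0 h)\<close>, the correlation of \<open>v\<close> with the negative part of \<open>h\<close> is zero because the two
have disjoint supports. Equality of potentials forces the correlation with the positive part to vanish as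
well, so \<open>h\<close> is nonpositive at almost every time of almost every path; continuity carries this to the
starting point.
\<close>

lemma potential_zero_nonpos:
  fixes h :: "'e \<Rightarrow> real \<Rightarrow> real"
  assumes h: "\<And>\<beta>. continuous_on UNIV (h \<beta>)"
    and fin: "\<And>\<beta> z T. potential T (\<lambda>\<beta> z. ennreal (h \<beta> z)) \<beta> z < \<infinity>"
    and eq: "\<And>\<beta> z T. 0 \<le> T \<Longrightarrow> potential T (\<lambda>\<beta> z. ennreal (h \<beta> z)) \<beta> z = potential T (\<lambda>\<beta> z. ennreal (- h \<beta> z)) \<beta> z"
  shows "h \<alpha> x \<le> 0"
proof (rule ccontr)
  assume "\<not> h \<alpha> x \<le> 0"
  then have pos: "0 < h \<alpha> x" by simp
  interpret a: prob_space "P \<alpha> x" by (rule prob_space)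
  define v where "v \<beta> z = min 1 (max 0 (h \<beta> z))" for \<beta> z
  have v: "continuous_on UNIV (v \<beta>)" "0 \<le> v \<beta> z" "v \<beta> z \<le> 1" for \<beta> z
    unfolding v_def by (auto intro!: continuous_intros h)
  have hb: "h \<beta> \<in> borel_measurable borel" "v \<beta> \<in> borel_measurable borel" for \<beta>
    using h v(1) by (simp_all add: borel_measurable_continuous_onI)
  have hb': "(\<lambda>z. - h \<beta> z) \<in> borel_measurable borel" "(\<lambda>z. ennreal (h \<beta> z)) \<in> borel_measurable borel"
    "(\<lambda>z. ennreal (- h \<beta> z)) \<in> borel_measurable borel" "(\<lambda>z. ennreal (v \<beta> z)) \<in> borel_measurable borel" for \<beta>
    using hb by simp_all
  have fin': "potential 1 (\<lambda>\<beta> z. ennreal (- h \<beta> z)) \<alpha> x < \<infinity>"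
    using fin[of 1 \<alpha> x] eq[of 1] by simp
  \<comment> \<open>The grid sums of the two parts of \<open>h\<close> agree for every mesh, hence so do their limits.\<close>
  have L1: "(\<lambda>n. \<integral>\<^sup>+u. (\<integral>\<^sup>+\<omega>. ennreal (v (Jp (grid n u) \<omega>) (Xp (grid n u) \<omega>)) * ennreal (h (Jp u \<omega>) (Xp u \<omega>)) \<partial>P \<alpha> x) * indicator {0..<1} u \<partial>lborel)
    \<longlonglongrightarrow> (\<integral>\<^sup>+\<omega>. (\<integral>\<^sup>+u. ennreal (v (Jp u \<omega>) (Xp u \<omega>) * h (Jp u \<omega>) (Xp u \<omega>)) * indicator {0..<1} u \<partial>lborel) \<partial>P \<alpha> x)"
    by (rule grid_limit[where v=v and h=h, OF v hb(1) fin])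
  have L2: "(\<lambda>n. \<integral>\<^sup>+u. (\<integral>\<^sup>+\<omega>. ennreal (v (Jp (grid n u) \<omega>) (Xp (grid n u) \<omega>)) * ennreal (- h (Jp u \<omega>) (Xp u \<omega>)) \<partial>P \<alpha> x) * indicator {0..<1} u \<partial>lborel)
    \<longlonglongrightarrow> (\<integral>\<^sup>+\<omega>. (\<integral>\<^sup>+u. ennreal (v (Jp u \<omega>) (Xp u \<omega>) * - h (Jp u \<omega>) (Xp u \<omega>)) * indicator {0..<1} u \<partial>lborel) \<partial>P \<alpha> x)"
    by (rule grid_limit[where v=v and h="\<lambda>\<beta> z. - h \<beta> z", OF v hb'(1) fin'])
  have "(\<integral>\<^sup>+u. (\<integral>\<^sup>+\<omega>. ennreal (v (Jp (grid n u) \<omega>) (Xp (grid n u) \<omega>)) * ennreal (h (Jp u \<omega>) (Xp u \<omega>)) \<partial>P \<alpha> x) * indicator {0..<1} u \<partial>lborel)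
    = (\<integral>\<^sup>+u. (\<integral>\<^sup>+\<omega>. ennreal (v (Jp (grid n u) \<omega>) (Xp (grid n u) \<omega>)) * ennreal (- h (Jp u \<omega>) (Xp u \<omega>)) \<partial>P \<alpha> x) * indicator {0..<1} u \<partial>lborel)" for n
    unfolding grid_potential[where v="\<lambda>\<beta> z. ennreal (v \<beta> z)" and w="\<lambda>\<beta> z. ennreal (h \<beta> z)", OF hb'(4) hb'(2)]
      grid_potential[where v="\<lambda>\<beta> z. ennreal (v \<beta> z)" and w="\<lambda>\<beta> z. ennreal (- h \<beta> z)", OF hb'(4) hb'(3)]
    by (simp add: eq)
  then have "(\<integral>\<^sup>+\<omega>. (\<integral>\<^sup>+u. ennreal (v (Jp u \<omega>) (Xp u \<omega>) * h (Jp u \<omega>) (Xp u \<omega>)) * indicator {0..<1} u \<partial>lborel) \<partial>P \<alpha> x)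
    = (\<integral>\<^sup>+\<omega>. (\<integral>\<^sup>+u. ennreal (v (Jp u \<omega>) (Xp u \<omega>) * - h (Jp u \<omega>) (Xp u \<omega>)) * indicator {0..<1} u \<partial>lborel) \<partial>P \<alpha> x)"
    using L1 L2 by (simp add: LIMSEQ_unique)
  also have "\<dots> = (\<integral>\<^sup>+\<omega>. (\<integral>\<^sup>+u. 0 \<partial>lborel) \<partial>P \<alpha> x)"
  proof -
    have "v \<beta> z * - h \<beta> z \<le> 0" for \<beta> z
      unfolding v_def by (auto simp: min_def max_def mult_nonneg_nonneg not_le intro: less_imp_le)
    then show ?thesis by (intro nn_integral_cong) (simp add: ennreal_neg)
  qed
  finally have zero: "(\<integral>\<^sup>+\<omega>. (\<integral>\<^sup>+u. ennreal (v (Jp u \<omega>) (Xp u \<omega>) * h (Jp u \<omega>) (Xp u \<omega>)) * indicator {0..<1} u \<partial>lborel) \<partial>P \<alpha> x) = 0"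
    by simp
  have vh: "(\<lambda>p. ennreal (v (Jp (fst p) (snd p)) (Xp (fst p) (snd p)) * h (Jp (fst p) (snd p)) (Xp (fst p) (snd p)))) \<in> borel_measurable (borel \<Otimes>\<^sub>M P \<alpha> x)"
    by (intro measurable_compose[OF _ measurable_ennreal] borel_measurable_times
        measurable_path_pair[where w=v, OF hb(2)] measurable_path_pair[where w=h, OF hb(1)])
  have vhi: "(\<lambda>p. ennreal (v (Jp (fst p) (snd p)) (Xp (fst p) (snd p)) * h (Jp (fst p) (snd p)) (Xp (fst p) (snd p))) * indicator {0..<1} (fst p)) \<in> borel_measurable (borel \<Otimes>\<^sub>M P \<alpha> x)"
    by (intro borel_measurable_times_ennreal vh measurable_compose[OF measurable_fst]) simp
  have "(\<lambda>\<omega>. \<integral>\<^sup>+u. ennreal (v (Jp u \<omega>) (Xp u \<omega>) * h (Jp u \<omega>) (Xp u \<omega>)) * indicator {0..<1} u \<partial>lborel) \<in> borel_measurable (P \<alpha> x)"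
    using measurable_compose[OF measurable_pair_swap' vhi]
    by (intro lborel.borel_measurable_nn_integral) (simp add: case_prod_unfold)
  then have "AE \<omega> in P \<alpha> x. (\<integral>\<^sup>+u. ennreal (v (Jp u \<omega>) (Xp u \<omega>) * h (Jp u \<omega>) (Xp u \<omega>)) * indicator {0..<1} u \<partial>lborel) = 0"
    using zero by (simp add: nn_integral_0_iff_AE)
  then have "AE \<omega> in P \<alpha> x. (\<integral>\<^sup>+u. ennreal (v (Jp u \<omega>) (Xp u \<omega>) * h (Jp u \<omega>) (Xp u \<omega>)) * indicator {0..<1} u \<partial>lborel) = 0
      \<and> J 0 \<omega> = \<alpha> \<and> \<xi> 0 \<omega> = x \<and> \<omega> \<in> \<Omega>"
    using start[of \<alpha> x] AE_space[of "P \<alpha> x"] by eventually_elim (simp add: space_P)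
  from eventually_happens[OF this] obtain \<omega> where
    o: "\<omega> \<in> \<Omega>" "J 0 \<omega> = \<alpha>" "\<xi> 0 \<omega> = x" and
    z: "(\<integral>\<^sup>+u. ennreal (v (Jp u \<omega>) (Xp u \<omega>) * h (Jp u \<omega>) (Xp u \<omega>)) * indicator {0..<1} u \<partial>lborel) = 0"
    using a.ae_filter_bot a.prob_space_axioms by (auto simp: trivial_limit_def)
  have "(\<lambda>u. ennreal (v (Jp u \<omega>) (Xp u \<omega>) * h (Jp u \<omega>) (Xp u \<omega>)) * indicator {0..<1} u) \<in> borel_measurable lborel"
    using measurable_compose[OF measurable_Pair2' vhi, of \<omega>] o(1) by (simp add: space_P)
  then have ae: "AE u in lborel. ennreal (v (Jp u \<omega>) (Xp u \<omega>) * h (Jp u \<omega>) (Xp u \<omega>)) * indicator {0..<1::real} u = 0"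
    using z by (simp add: nn_integral_0_iff_AE)
  \<comment> \<open>The path would keep \<open>h\<close> positive on an interval, contrary to \<open>ae\<close>.\<close>
  have "\<forall>\<^sub>F s in at_right 0. 0 < h (Jp s \<omega>) (Xp s \<omega>)"
    using order_tendstoD(1)[OF path_right_limit[where v=h, OF h o(1) order_refl], of 0] pos o by simp
  then obtain d where d: "0 < d" "\<And>s. 0 < s \<Longrightarrow> s < d \<Longrightarrow> 0 < h (Jp s \<omega>) (Xp s \<omega>)"
    by (auto simp: eventually_at_right_field)
  have "AE u in lborel. u \<notin> {0<..<min d (1::real)}"
    using ae
  proof eventually_elim
    case (elim u)
    show ?case
    proof
      assume u: "u \<in> {0<..<min d 1}"
      then have "0 < h (Jp u \<omega>) (Xp u \<omega>)" using d(2)[of u] by auto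
      then have "0 < v (Jp u \<omega>) (Xp u \<omega>) * h (Jp u \<omega>) (Xp u \<omega>)" by (simp add: v_def)
      then show False using elim u by (auto simp: ennreal_eq_0_iff)
    qed
  qed
  then have "emeasure lborel {0<..<min d (1::real)} = 0"
    using AE_iff_null_sets[of "{0<..<min d (1::real)}" lborel] by (auto dest: null_setsD1)
  then show False using d(1) by simp
qed

lemma potential_zero:
  fixes h :: "'e \<Rightarrow> real \<Rightarrow> real"
  assumes h: "\<And>\<beta>. continuous_on UNIV (h \<beta>)"
    and fin: "\<And>\<beta> z T. potential T (\<lambda>\<beta> z. ennreal (h \<beta> z)) \<beta> z < \<infinity>"
    and fin': "\<And>\<beta> z T. potential T (\<lambda>\<beta> z. ennreal (- h \<beta> z)) \<beta> z < \<infinity>"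
    and eq: "\<And>\<beta> z T. 0 \<le> T \<Longrightarrow> potential T (\<lambda>\<beta> z. ennreal (h \<beta> z)) \<beta> z = potential T (\<lambda>\<beta> z. ennreal (- h \<beta> z)) \<beta> z"
  shows "h \<alpha> x = 0"
proof (rule antisym)
  show "h \<alpha> x \<le> 0" by (rule potential_zero_nonpos[where h=h, OF h fin eq])
  have "- h \<alpha> x \<le> 0"
    by (rule potential_zero_nonpos[where h="\<lambda>\<beta> z. - h \<beta> z"])
      (use fin' eq in \<open>auto intro!: continuous_on_minus h\<close>)
  then show "0 \<le> h \<alpha> x" by simp
qed

end

section \<open>The generator of the price\<close>

lemma real_parts_eq:
  fixes f :: "'a \<Rightarrow> real"
  assumes "integrable M f" "integral\<^sup>L M f = 0"
  shows "(\<integral>\<^sup>+p. ennreal (f p) \<partial>M) = (\<integral>\<^sup>+p. ennreal (- f p) \<partial>M)" "(\<integral>\<^sup>+p. ennreal (f p) \<partial>M) < \<infinity>"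
    "(\<integral>\<^sup>+p. ennreal (- f p) \<partial>M) < \<infinity>"
proof -
  have fin: "(\<integral>\<^sup>+p. ennreal (f p) \<partial>M) < \<infinity>" "(\<integral>\<^sup>+p. ennreal (- f p) \<partial>M) < \<infinity>"
    using integrableD(2,3)[OF assms(1)] by (simp_all add: less_top)
  show "(\<integral>\<^sup>+p. ennreal (f p) \<partial>M) < \<infinity>" "(\<integral>\<^sup>+p. ennreal (- f p) \<partial>M) < \<infinity>" by fact+
  have "enn2real (\<integral>\<^sup>+p. ennreal (f p) \<partial>M) = enn2real (\<integral>\<^sup>+p. ennreal (- f p) \<partial>M)"
    using real_lebesgue_integral_def[OF assms(1)] assms(2) by simp
  then show "(\<integral>\<^sup>+p. ennreal (f p) \<partial>M) = (\<integral>\<^sup>+p. ennreal (- f p) \<partial>M)"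
    using fin by (metis ennreal_enn2real infinity_ennreal_def)
qed

lemma finite_measure_interval: "finite_measure (restrict_space lborel {0..T::real})"
  by (rule finite_measureI, cases "0 \<le> T") (simp_all add: space_restrict_space emeasure_restrict_space)

context markov_additive_process
begin

text \<open>
On this finite measure space, integrals along paths up to time \<open>T\<close> become single integrals.
\<close>

abbreviation occupation_space :: "real \<Rightarrow> 'e \<Rightarrow> real \<Rightarrow> (real \<times> 'a) measure" where
  "occupation_space T \<alpha> x \<equiv> restrict_space lborel {0..T} \<Otimes>\<^sub>M P \<alpha> x"

lemma pair_sigma_finite_occupation: "pair_sigma_finite (restrict_space lborel {0..T::real}) (P \<alpha> x)"
proof -
  interpret a: prob_space "P \<alpha> x" by (rule prob_space)
  interpret l: finite_measure "restrict_space lborel {0..T}" by (rule finite_measure_interval)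
  show ?thesis ..
qed

lemma measurable_occupation:
  assumes w: "\<And>\<beta>. w \<beta> \<in> borel_measurable borel"
  shows "(\<lambda>p. w (J (fst p) (snd p)) (\<xi> (fst p) (snd p))) \<in> borel_measurable (occupation_space T \<alpha> x)"
proof -
  have 1: "(\<lambda>u::real. u) \<in> restrict_space lborel {0..T} \<rightarrow>\<^sub>M borel"
    by (rule measurable_restrict_space1) simp
  have "(\<lambda>p. (fst p, snd p)) \<in> occupation_space T \<alpha> x \<rightarrow>\<^sub>M borel \<Otimes>\<^sub>M P \<alpha> x"
    by (intro measurable_Pair measurable_compose[OF measurable_fst 1] measurable_snd)
  from measurable_compose[OF this measurable_path_pair[where w=w, OF w]]
  have "(\<lambda>p. w (Jp (fst p) (snd p)) (Xp (fst p) (snd p))) \<in> borel_measurable (occupation_space T \<alpha> x)"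
    by simp
  then show ?thesis
    by (rule measurable_cong[THEN iffD1, rotated]) (auto simp: space_pair_measure space_restrict_space)
qed

lemma nn_integral_occupation:
  assumes w: "\<And>\<beta>. w \<beta> \<in> borel_measurable borel"
  shows "(\<integral>\<^sup>+p. w (J (fst p) (snd p)) (\<xi> (fst p) (snd p)) \<partial>occupation_space T \<alpha> x) = potential T w \<alpha> x"
    and "(\<integral>\<^sup>+p. w (J (fst p) (snd p)) (\<xi> (fst p) (snd p)) \<partial>occupation_space T \<alpha> x)
      = (\<integral>\<^sup>+\<omega>. (\<integral>\<^sup>+u\<in>{0..T}. w (J u \<omega>) (\<xi> u \<omega>) \<partial>lborel) \<partial>P \<alpha> x)"
proof -
  interpret pair_sigma_finite "restrict_space lborel {0..T}" "P \<alpha> x" by (rule pair_sigma_finite_occupation)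
  note m = measurable_occupation[where w=w, OF w, of T \<alpha> x]
  have "(\<integral>\<^sup>+p. w (J (fst p) (snd p)) (\<xi> (fst p) (snd p)) \<partial>occupation_space T \<alpha> x)
    = (\<integral>\<^sup>+u. (\<integral>\<^sup>+\<omega>. w (J u \<omega>) (\<xi> u \<omega>) \<partial>P \<alpha> x) \<partial>restrict_space lborel {0..T})"
    using M2.nn_integral_fst[OF m] by simp
  also have "\<dots> = (\<integral>\<^sup>+u. (\<integral>\<^sup>+\<omega>. w (J u \<omega>) (\<xi> u \<omega>) \<partial>P \<alpha> x) * indicator {0..T} u \<partial>lborel)"
    by (rule nn_integral_restrict_space) simp
  also have "\<dots> = potential T w \<alpha> x"
    unfolding potential_def
  proof (rule nn_integral_cong_AE)
    show "AE u in lborel. (\<integral>\<^sup>+\<omega>. w (J u \<omega>) (\<xi> u \<omega>) \<partial>P \<alpha> x) * indicator {0..T} u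
        = (\<integral>\<^sup>+\<omega>. w (Jp u \<omega>) (Xp u \<omega>) \<partial>P \<alpha> x) * indicator {0..<T} u"
      using AE_lborel_singleton[of T]
    proof eventually_elim
      case (elim u)
      then show ?case by (cases "u \<in> {0..<T}") (auto simp: indicator_def)
    qed
  qed
  finally show "(\<integral>\<^sup>+p. w (J (fst p) (snd p)) (\<xi> (fst p) (snd p)) \<partial>occupation_space T \<alpha> x) = potential T w \<alpha> x" .
  have "(\<integral>\<^sup>+p. w (J (fst p) (snd p)) (\<xi> (fst p) (snd p)) \<partial>occupation_space T \<alpha> x)
    = (\<integral>\<^sup>+\<omega>. (\<integral>\<^sup>+u. w (J u \<omega>) (\<xi> u \<omega>) \<partial>restrict_space lborel {0..T}) \<partial>P \<alpha> x)"
    using nn_integral_snd[OF m] by simp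
  then show "(\<integral>\<^sup>+p. w (J (fst p) (snd p)) (\<xi> (fst p) (snd p)) \<partial>occupation_space T \<alpha> x)
      = (\<integral>\<^sup>+\<omega>. (\<integral>\<^sup>+u\<in>{0..T}. w (J u \<omega>) (\<xi> u \<omega>) \<partial>lborel) \<partial>P \<alpha> x)"
    by (simp add: nn_integral_restrict_space)
qed

lemma potential_shift:
  assumes w: "\<And>\<beta>. w \<beta> \<in> borel_measurable borel"
  shows "potential T (\<lambda>\<beta> z. w \<beta> (z + c)) \<alpha> x = potential T w \<alpha> (x + c)"
proof -
  have m: "(\<lambda>z. w \<beta> (z + c)) \<in> borel_measurable borel" for \<beta>
    using w by measurable
  have "transition u (\<lambda>\<beta> z. w \<beta> (z + c)) \<alpha> x = transition u w \<alpha> (x + c)" for u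
    by (simp add: transition_def add.assoc)
  then show ?thesis
    unfolding potential_def
    by (simp add: nn_integral_state[where w=w, OF _ w] nn_integral_state[where w="\<lambda>\<beta> z. w \<beta> (z + c)", OF _ m])
qed

lemma occupation_shift:
  fixes w :: "'e \<Rightarrow> real \<Rightarrow> real"
  assumes w: "\<And>\<beta>. w \<beta> \<in> borel_measurable borel"
    and int: "integrable (occupation_space T \<alpha> (x + c)) (\<lambda>p. w (J (fst p) (snd p)) (\<xi> (fst p) (snd p)))"
  shows "integrable (occupation_space T \<alpha> x) (\<lambda>p. w (J (fst p) (snd p)) (\<xi> (fst p) (snd p) + c))"
    and "(\<integral>p. w (J (fst p) (snd p)) (\<xi> (fst p) (snd p) + c) \<partial>occupation_space T \<alpha> x)
      = (\<integral>p. w (J (fst p) (snd p)) (\<xi> (fst p) (snd p)) \<partial>occupation_space T \<alpha> (x + c))"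
proof -
  have m: "(\<lambda>z. w \<beta> (z + c)) \<in> borel_measurable borel" for \<beta>
    using w by measurable
  have eq: "(\<integral>\<^sup>+p. v (J (fst p) (snd p)) (\<xi> (fst p) (snd p) + c) \<partial>occupation_space T \<alpha> x)
      = (\<integral>\<^sup>+p. v (J (fst p) (snd p)) (\<xi> (fst p) (snd p)) \<partial>occupation_space T \<alpha> (x + c))"
    if v: "\<And>\<beta>. v \<beta> \<in> borel_measurable borel" for v :: "'e \<Rightarrow> real \<Rightarrow> ennreal"
  proof -
    have m: "(\<lambda>z. v \<beta> (z + c)) \<in> borel_measurable borel" for \<beta>
      using v by measurable
    show ?thesis
      using nn_integral_occupation(1)[where w=v, OF v, of T \<alpha> "x + c"]
        nn_integral_occupation(1)[where w="\<lambda>\<beta> z. v \<beta> (z + c)", OF m, of T \<alpha> x]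
        potential_shift[where w=v, OF v, of T c \<alpha> x] by simp
  qed
  \<comment> \<open>A real integral is determined by those of its positive and negative parts.\<close>
  have pm: "(\<lambda>z. ennreal (w \<beta> z)) \<in> borel_measurable borel" "(\<lambda>z. ennreal (- w \<beta> z)) \<in> borel_measurable borel"
    for \<beta> using w[of \<beta>] by simp_all
  note e = eq[where v="\<lambda>\<beta> z. ennreal (w \<beta> z)", OF pm(1)] eq[where v="\<lambda>\<beta> z. ennreal (- w \<beta> z)", OF pm(2)]
  show i: "integrable (occupation_space T \<alpha> x) (\<lambda>p. w (J (fst p) (snd p)) (\<xi> (fst p) (snd p) + c))"
    using int measurable_occupation[where w="\<lambda>\<beta> z. w \<beta> (z + c)", OF m, of T \<alpha> x]
    unfolding real_integrable_def e by simp
  show "(\<integral>p. w (J (fst p) (snd p)) (\<xi> (fst p) (snd p) + c) \<partial>occupation_space T \<alpha> x)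
      = (\<integral>p. w (J (fst p) (snd p)) (\<xi> (fst p) (snd p)) \<partial>occupation_space T \<alpha> (x + c))"
    unfolding real_lebesgue_integral_def[OF int] real_lebesgue_integral_def[OF i] e ..
qed

lemma time_integral_eq:
  "(LINT s:{0..T}|lborel. f s) = (\<integral>s. f s \<partial>restrict_space lborel {0..T::real})" for f :: "real \<Rightarrow> real"
  by (simp add: set_lebesgue_integral_def integral_restrict_space)

text \<open>
Dynkin's martingale starts at \<open>0\<close>, so its mean is \<open>0\<close> at all times; this is the formula for the mean of
the price.
\<close>

lemma price_generatorD:
  assumes g: "price_generator F P J \<xi> g"
  shows "continuous_on UNIV (\<lambda>z. g (\<beta>, exp z))"
    and "0 \<le> t \<Longrightarrow> integrable (occupation_space t \<alpha> x) (\<lambda>p. g (J (fst p) (snd p), exp (\<xi> (fst p) (snd p))))"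
    and "0 \<le> t \<Longrightarrow> integrable (P \<alpha> x) (\<lambda>\<omega>. exp (\<xi> t \<omega>))"
    and "0 \<le> t \<Longrightarrow> (\<integral>\<omega>. exp (\<xi> t \<omega>) \<partial>P \<alpha> x) = exp x + (\<integral>p. g (J (fst p) (snd p), exp (\<xi> (fst p) (snd p))) \<partial>occupation_space t \<alpha> x)"
proof -
  let ?S = "count_space UNIV \<Otimes>\<^sub>M restrict_space borel {0<..} :: ('e \<times> real) measure"
  have cont: "continuous_on {0<..} (\<lambda>y. g (\<beta>, y))" for \<beta>
    using g by (simp add: price_generator_def)
  show C: "continuous_on UNIV (\<lambda>z. g (\<beta>, exp z))" for \<beta>
    by (rule continuous_on_compose2[OF cont]) (auto intro!: continuous_intros)
  then have gm: "(\<lambda>z. g (\<beta>, exp z)) \<in> borel_measurable borel" for \<beta>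
    by (simp add: borel_measurable_continuous_onI)
  have "(\<alpha>, exp x) \<in> space ?S" by (simp add: space_pair_measure space_restrict_space)
  then have "(\<lambda>(\<alpha>, y). P \<alpha> (ln y)) (\<alpha>, exp x) = P \<alpha> x" "(\<alpha>, exp x) \<in> space ?S" by simp_all
  note at = this
  have E: "extended_generator ?S (\<lambda>(\<alpha>, y). P \<alpha> (ln y)) F (\<lambda>t \<omega>. (J t \<omega>, exp (\<xi> t \<omega>))) (\<lambda>(\<alpha>, y). y) g"
    using g unfolding price_generator_def by (rule conjunct1)
  have G: "\<forall>t\<ge>0. (\<integral>\<^sup>+\<omega>. (\<integral>\<^sup>+s\<in>{0..t}. ennreal \<bar>g (J s \<omega>, exp (\<xi> s \<omega>))\<bar> \<partial>lborel) \<partial>P \<alpha> x) < \<infinity>"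
    "martingale_wrt (P \<alpha> x) F (\<lambda>t \<omega>. exp (\<xi> t \<omega>) - exp (\<xi> 0 \<omega>) - (LINT s:{0..t}|lborel. g (J s \<omega>, exp (\<xi> s \<omega>))))"
    using bspec[OF E[unfolded extended_generator_def, THEN conjunct2, THEN conjunct2] at(2)]
    unfolding at(1) by simp_all
  assume t: "0 \<le> t"
  interpret a: prob_space "P \<alpha> x" by (rule prob_space)
  interpret pair_sigma_finite "restrict_space lborel {0..t}" "P \<alpha> x" by (rule pair_sigma_finite_occupation)
  show I: "integrable (occupation_space t \<alpha> x) (\<lambda>p. g (J (fst p) (snd p), exp (\<xi> (fst p) (snd p))))"
  proof (rule integrableI_bounded)
    show "(\<lambda>p. g (J (fst p) (snd p), exp (\<xi> (fst p) (snd p)))) \<in> borel_measurable (occupation_space t \<alpha> x)"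
      by (rule measurable_occupation[where w="\<lambda>\<beta> z. g (\<beta>, exp z)", OF gm])
    have "(\<lambda>z. ennreal \<bar>g (\<beta>, exp z)\<bar>) \<in> borel_measurable borel" for \<beta> using gm[of \<beta>] by simp
    from nn_integral_occupation(2)[where w="\<lambda>\<beta> z. ennreal \<bar>g (\<beta>, exp z)\<bar>", OF this, of t \<alpha> x]
    show "(\<integral>\<^sup>+p. ennreal (norm (g (J (fst p) (snd p), exp (\<xi> (fst p) (snd p))))) \<partial>occupation_space t \<alpha> x) < \<infinity>"
      using G(1) t by simp
  qed
  \<comment> \<open>Dynkin's martingale\<close>
  define D where "D t \<omega> = exp (\<xi> t \<omega>) - exp (\<xi> 0 \<omega>) - (LINT s:{0..t}|lborel. g (J s \<omega>, exp (\<xi> s \<omega>)))" for t \<omega>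
  have D: "integrable (P \<alpha> x) (D t)" "AE \<omega> in P \<alpha> x. real_cond_exp (P \<alpha> x) (F 0) (D t) \<omega> = D 0 \<omega>"
    using G(2) t unfolding martingale_wrt_def D_def by auto
  have D0: "D 0 \<omega> = 0" for \<omega>
  proof -
    have "(LINT s:{0..0}|lborel. g (J s \<omega>, exp (\<xi> s \<omega>))) = 0"
      unfolding set_lebesgue_integral_def
      by (rule integral_eq_zero_AE) (use AE_lborel_singleton[of 0] in \<open>eventually_elim, simp\<close>)
    then show ?thesis by (simp add: D_def)
  qed
  have ED: "(\<integral>\<omega>. D t \<omega> \<partial>P \<alpha> x) = 0"
  proof -
    interpret finite_measure_subalgebra "P \<alpha> x" "F 0"
      by unfold_locales (rule subalgebra_F, simp)
    have "(\<integral>\<omega>. D t \<omega> \<partial>P \<alpha> x) = (\<integral>\<omega>. real_cond_exp (P \<alpha> x) (F 0) (D t) \<omega> \<partial>P \<alpha> x)"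
      using real_cond_exp_int(2)[OF D(1)] by simp
    also have "\<dots> = (\<integral>\<omega>. 0 \<partial>P \<alpha> x)"
      by (rule integral_cong_AE) (use D(2) D0 in auto)
    finally show ?thesis by simp
  qed
  have A: "integrable (P \<alpha> x) (\<lambda>\<omega>. LINT s:{0..t}|lborel. g (J s \<omega>, exp (\<xi> s \<omega>)))"
    and EA: "(\<integral>\<omega>. (LINT s:{0..t}|lborel. g (J s \<omega>, exp (\<xi> s \<omega>))) \<partial>P \<alpha> x)
      = (\<integral>p. g (J (fst p) (snd p), exp (\<xi> (fst p) (snd p))) \<partial>occupation_space t \<alpha> x)"
    using integrable_snd[of "\<lambda>u \<omega>. g (J u \<omega>, exp (\<xi> u \<omega>))"] integral_snd[of "\<lambda>u \<omega>. g (J u \<omega>, exp (\<xi> u \<omega>))"] I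
    by (simp_all add: time_integral_eq case_prod_unfold)
  have st: "AE \<omega> in P \<alpha> x. exp (\<xi> t \<omega>) = D t \<omega> + exp x + (LINT s:{0..t}|lborel. g (J s \<omega>, exp (\<xi> s \<omega>)))"
    using start[of \<alpha> x] by eventually_elim (simp add: D_def)
  have m: "(\<lambda>\<omega>. exp (\<xi> t \<omega>)) \<in> borel_measurable (P \<alpha> x)"
    using measurable_path(2)[OF t, of \<alpha> x] by measurable
  have i: "integrable (P \<alpha> x) (\<lambda>\<omega>. D t \<omega> + exp x + (LINT s:{0..t}|lborel. g (J s \<omega>, exp (\<xi> s \<omega>))))"
    using D(1) A by simp
  show "integrable (P \<alpha> x) (\<lambda>\<omega>. exp (\<xi> t \<omega>))"
    using i st m by (subst integrable_cong_AE[OF m _ st]) auto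
  have "(\<integral>\<omega>. exp (\<xi> t \<omega>) \<partial>P \<alpha> x) = (\<integral>\<omega>. D t \<omega> + exp x + (LINT s:{0..t}|lborel. g (J s \<omega>, exp (\<xi> s \<omega>))) \<partial>P \<alpha> x)"
    by (rule integral_cong_AE[OF m _ st]) (use i in auto)
  also have "\<dots> = exp x + (\<integral>p. g (J (fst p) (snd p), exp (\<xi> (fst p) (snd p))) \<partial>occupation_space t \<alpha> x)"
    using D(1) A by (simp add: ED EA a.prob_space)
  finally show "(\<integral>\<omega>. exp (\<xi> t \<omega>) \<partial>P \<alpha> x) = exp x + (\<integral>p. g (J (fst p) (snd p), exp (\<xi> (fst p) (snd p))) \<partial>occupation_space t \<alpha> x)" .
qed

lemma expected_price_scaling:
  assumes t: "0 \<le> t" and int: "\<And>x. integrable (P \<alpha> x) (\<lambda>\<omega>. exp (\<xi> t \<omega>))"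
  shows "(\<integral>\<omega>. exp (\<xi> t \<omega>) \<partial>P \<alpha> x) = exp x * (\<integral>\<omega>. exp (\<xi> t \<omega>) \<partial>P \<alpha> 0)"
proof -
  have m: "(\<lambda>z. ennreal (exp z)) \<in> borel_measurable borel" by measurable
  have mt: "(\<lambda>\<omega>. ennreal (exp (\<xi> t \<omega>))) \<in> borel_measurable (P \<alpha> 0)"
    using measurable_path(2)[OF t] by measurable
  have "ennreal (\<integral>\<omega>. exp (\<xi> t \<omega>) \<partial>P \<alpha> x) = (\<integral>\<^sup>+\<omega>. ennreal (exp (\<xi> t \<omega>)) \<partial>P \<alpha> x)"
    using int by (simp add: nn_integral_eq_integral)
  also have "\<dots> = (\<integral>\<^sup>+\<omega>. ennreal (exp x) * ennreal (exp (\<xi> t \<omega>)) \<partial>P \<alpha> 0)"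
    using nn_integral_state[where w="\<lambda>_ z. ennreal (exp z)", OF t m, of \<alpha> x]
    by (simp add: transition_def exp_add ennreal_mult mult.commute)
  also have "\<dots> = ennreal (exp x) * (\<integral>\<^sup>+\<omega>. ennreal (exp (\<xi> t \<omega>)) \<partial>P \<alpha> 0)"
    by (rule nn_integral_cmult[OF mt])
  also have "\<dots> = ennreal (exp x * (\<integral>\<omega>. exp (\<xi> t \<omega>) \<partial>P \<alpha> 0))"
    using int by (simp add: nn_integral_eq_integral ennreal_mult)
  finally show ?thesis by (simp add: ennreal_inj)
qed

text \<open>
The function \<open>h\<close> in the proof compares the generator with its conjugate under multiplication of the price
by \<open>exp c\<close>. Both sides integrate to the same mean price, because the mean price is proportional to the
initial price. Hence \<open>h\<close> has zero potential and vanishes.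
\<close>

lemma price_generator_homogeneous:
  assumes g: "price_generator F P J \<xi> g"
  shows "g (\<alpha>, exp c) = exp c * g (\<alpha>, 1)"
proof -
  note C = price_generatorD(1)[OF g]
  have gm: "(\<lambda>z. g (\<beta>, exp z)) \<in> borel_measurable borel" for \<beta>
    using C by (simp add: borel_measurable_continuous_onI)
  define h where "h \<beta> z = exp (- c) * g (\<beta>, exp (z + c)) - g (\<beta>, exp z)" for \<beta> z
  have hc: "continuous_on UNIV (h \<beta>)" for \<beta>
    unfolding h_def by (intro continuous_intros continuous_on_compose2[OF C]) auto
  have hm: "h \<beta> \<in> borel_measurable borel" for \<beta>
    using hc by (simp add: borel_measurable_continuous_onI)
  have hm': "(\<lambda>z. ennreal (h \<beta> z)) \<in> borel_measurable borel" "(\<lambda>z. ennreal (- h \<beta> z)) \<in> borel_measurable borel" for \<beta>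
    using hm[of \<beta>] by simp_all
  have main: "integrable (occupation_space T \<beta> z) (\<lambda>p. h (J (fst p) (snd p)) (\<xi> (fst p) (snd p)))"
    "(\<integral>p. h (J (fst p) (snd p)) (\<xi> (fst p) (snd p)) \<partial>occupation_space T \<beta> z) = 0" if T: "0 \<le> T" for T \<beta> z
  proof -
    note i1 = price_generatorD(2)[OF g T, of \<beta> z] and i2 = price_generatorD(2)[OF g T, of \<beta> "z + c"]
    note sh = occupation_shift[where w="\<lambda>\<beta> z. g (\<beta>, exp z)", OF gm i2]
    show "integrable (occupation_space T \<beta> z) (\<lambda>p. h (J (fst p) (snd p)) (\<xi> (fst p) (snd p)))"
      unfolding h_def using i1 sh(1) by auto
    have "(\<integral>p. h (J (fst p) (snd p)) (\<xi> (fst p) (snd p)) \<partial>occupation_space T \<beta> z)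
      = exp (- c) * (\<integral>p. g (J (fst p) (snd p), exp (\<xi> (fst p) (snd p))) \<partial>occupation_space T \<beta> (z + c))
        - (\<integral>p. g (J (fst p) (snd p), exp (\<xi> (fst p) (snd p))) \<partial>occupation_space T \<beta> z)"
      unfolding h_def using i1 sh by simp
    also have "\<dots> = exp (- c) * ((\<integral>\<omega>. exp (\<xi> T \<omega>) \<partial>P \<beta> (z + c)) - exp (z + c)) - ((\<integral>\<omega>. exp (\<xi> T \<omega>) \<partial>P \<beta> z) - exp z)"
      using price_generatorD(4)[OF g T, of \<beta> z] price_generatorD(4)[OF g T, of \<beta> "z + c"] by simp
    also have "\<dots> = 0"
      unfolding expected_price_scaling[OF T price_generatorD(3)[OF g T], of \<beta> "z + c"]
        expected_price_scaling[OF T price_generatorD(3)[OF g T], of \<beta> z]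
      by (simp add: exp_add exp_minus field_simps)
    finally show "(\<integral>p. h (J (fst p) (snd p)) (\<xi> (fst p) (snd p)) \<partial>occupation_space T \<beta> z) = 0" .
  qed
  have pot: "potential T (\<lambda>\<beta> z. ennreal (h \<beta> z)) \<beta> z = potential T (\<lambda>\<beta> z. ennreal (- h \<beta> z)) \<beta> z
    \<and> potential T (\<lambda>\<beta> z. ennreal (h \<beta> z)) \<beta> z < \<infinity> \<and> potential T (\<lambda>\<beta> z. ennreal (- h \<beta> z)) \<beta> z < \<infinity>" for T \<beta> z
  proof (cases "0 \<le> T")
    case True
    show ?thesis
      using real_parts_eq[OF main[OF True]] unfolding
        nn_integral_occupation(1)[where w="\<lambda>\<beta> z. ennreal (h \<beta> z)", OF hm'(1)]
        nn_integral_occupation(1)[where w="\<lambda>\<beta> z. ennreal (- h \<beta> z)", OF hm'(2)] by blast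
  next
    case False
    then show ?thesis by (simp add: potential_def)
  qed
  have "h \<alpha> 0 = 0"
    by (rule potential_zero[where h=h, OF hc]) (use pot in blast)+
  then show ?thesis by (simp add: h_def exp_minus field_simps)
qed

lemma expected_price_formula:
  assumes g: "price_generator F P J \<xi> g" and t: "0 \<le> t"
  shows "integrable (occupation_space t \<alpha> x) (\<lambda>p. exp (\<xi> (fst p) (snd p)) * g (J (fst p) (snd p), 1))"
    and "(\<integral>\<omega>. exp (\<xi> t \<omega>) \<partial>P \<alpha> x) = exp x + (\<integral>p. exp (\<xi> (fst p) (snd p)) * g (J (fst p) (snd p), 1) \<partial>occupation_space t \<alpha> x)"
  using price_generatorD(2,4)[OF g t] by (simp_all add: price_generator_homogeneous[OF g])

lemma emeasure_occupation_space:
  assumes "0 < T"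
  shows "emeasure (occupation_space T \<alpha> x) (space (occupation_space T \<alpha> x)) \<noteq> 0"
proof -
  interpret a: prob_space "P \<alpha> x" by (rule prob_space)
  have "emeasure (occupation_space T \<alpha> x) ({0..T} \<times> space (P \<alpha> x)) = ennreal T"
    using assms by (subst a.emeasure_pair_measure_Times)
      (simp_all add: sets_restrict_space_iff emeasure_restrict_space a.emeasure_space_1)
  then show ?thesis using assms by (simp add: space_pair_measure space_restrict_space)
qed

lemma finite_measure_occupation: "finite_measure (occupation_space T \<alpha> x)"
proof -
  interpret a: prob_space "P \<alpha> x" by (rule prob_space)
  interpret l: finite_measure "restrict_space lborel {0..T}" by (rule finite_measure_interval)
  show ?thesis by (rule finite_measure_pair_measure) unfold_locales
qed

lemma expected_price_increasing:
  assumes g: "price_generator F P J \<xi> g" and pos: "\<And>\<beta>. 0 < g (\<beta>, 1)" and t: "0 < t"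
  shows "exp x < (\<integral>\<omega>. exp (\<xi> t \<omega>) \<partial>P \<alpha> x)"
proof -
  note f = expected_price_formula[OF g less_imp_le[OF t], of \<alpha> x]
  have "(\<integral>p. 0 \<partial>occupation_space t \<alpha> x) < (\<integral>p. exp (\<xi> (fst p) (snd p)) * g (J (fst p) (snd p), 1) \<partial>occupation_space t \<alpha> x)"
    by (rule finite_measure.integral_less_AE_space[OF finite_measure_occupation _ f(1) _ emeasure_occupation_space[OF t]])
      (auto simp: pos)
  then show ?thesis using f(2) by simp
qed

lemma expected_price_decreasing:
  assumes g: "price_generator F P J \<xi> g" and neg: "\<And>\<beta>. g (\<beta>, 1) < 0" and t: "0 < t"
  shows "(\<integral>\<omega>. exp (\<xi> t \<omega>) \<partial>P \<alpha> x) < exp x"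
proof -
  note f = expected_price_formula[OF g less_imp_le[OF t], of \<alpha> x]
  have "(\<integral>p. exp (\<xi> (fst p) (snd p)) * g (J (fst p) (snd p), 1) \<partial>occupation_space t \<alpha> x) < (\<integral>p. 0 \<partial>occupation_space t \<alpha> x)"
    by (rule finite_measure.integral_less_AE_space[OF finite_measure_occupation f(1) _ _ emeasure_occupation_space[OF t]])
      (auto simp: neg mult_pos_neg)
  then show ?thesis using f(2) by simp
qed

end

section \<open>Comparison of the options\<close>

lemma call_payoff_nonneg: "0 \<le> call_payoff k x"
  by (simp add: call_payoff_def)

lemma call_payoff_mono: "x \<le> y \<Longrightarrow> call_payoff k x \<le> call_payoff k y"
  by (auto simp: call_payoff_def)

lemma measurable_call_payoff [measurable]: "call_payoff k \<in> borel_measurable borel"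
  unfolding call_payoff_def by measurable

lemma (in finite_measure) integrable_call_payoff:
  assumes "integrable M f"
  shows "integrable M (\<lambda>x. call_payoff k (f x))"
proof (rule Bochner_Integration.integrable_bound[where f="\<lambda>x. \<bar>f x\<bar> + \<bar>k\<bar>"])
  show "integrable M (\<lambda>x. \<bar>f x\<bar> + \<bar>k\<bar>)" using assms by simp
  show "(\<lambda>x. call_payoff k (f x)) \<in> borel_measurable M" using assms by measurable
qed (auto simp: call_payoff_def)

text \<open>
The mean payoff dominates both the mean of \<open>f - k\<close> and \<open>0\<close>, hence the larger of the two.
\<close>

lemma call_payoff_integral_le:
  assumes "prob_space M" and f: "integrable M f"
  shows "call_payoff k (\<integral>x. f x \<partial>M) \<le> (\<integral>x. call_payoff k (f x) \<partial>M)"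
proof -
  interpret prob_space M by fact
  have i: "integrable M (\<lambda>x. call_payoff k (f x))" by (rule integrable_call_payoff[OF f])
  have "(\<integral>x. f x \<partial>M) - k = (\<integral>x. f x - k \<partial>M)" using f by (simp add: prob_space)
  also have "\<dots> \<le> (\<integral>x. call_payoff k (f x) \<partial>M)"
    using f i by (intro Bochner_Integration.integral_mono) (auto simp: call_payoff_def)
  finally show ?thesis
    using Bochner_Integration.integral_nonneg[where f="\<lambda>x. call_payoff k (f x)" and M=M] call_payoff_nonneg
    by (auto simp: call_payoff_def)
qed

lemma call_payoff_time_average_le:
  assumes T: "0 < T" and f: "integrable (restrict_space lborel {0..T}) f"
  shows "call_payoff k (1 / T * (\<integral>s. f s \<partial>restrict_space lborel {0..T}))
    \<le> 1 / T * (\<integral>s. call_payoff k (f s) \<partial>restrict_space lborel {0..T})"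
proof -
  let ?L = "restrict_space lborel {0..T}"
  interpret finite_measure ?L by (rule finite_measure_interval)
  have i: "integrable ?L (\<lambda>x. call_payoff k (f x))" by (rule integrable_call_payoff[OF f])
  have m: "measure ?L (space ?L) = T"
    using T by (simp add: measure_restrict_space space_restrict_space)
  have "1 / T * (\<integral>s. f s \<partial>?L) - k = 1 / T * (\<integral>s. f s - k \<partial>?L)"
    using f T m by (simp add: field_simps)
  also have "\<dots> \<le> 1 / T * (\<integral>s. call_payoff k (f s) \<partial>?L)"
    using f i T by (intro mult_left_mono Bochner_Integration.integral_mono) (auto simp: call_payoff_def)
  finally show ?thesis
    using T Bochner_Integration.integral_nonneg[where f="\<lambda>x. call_payoff k (f x)" and M="?L"] call_payoff_nonneg
    by (auto simp: call_payoff_def)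
qed

text \<open>
The end point \<open>T\<close> is left out of the hypothesis because the comparisons between \<open>s\<close> and \<open>T\<close> are strict
only for \<open>s < T\<close>.
\<close>

lemma integral_less_interval:
  fixes f :: "real \<Rightarrow> real"
  assumes T: "0 < T" and f: "integrable (restrict_space lborel {0..T}) f"
    and less: "\<And>s. 0 \<le> s \<Longrightarrow> s < T \<Longrightarrow> f s < c"
  shows "1 / T * (\<integral>s. f s \<partial>restrict_space lborel {0..T}) < c"
proof -
  let ?L = "restrict_space lborel {0..T}"
  interpret finite_measure ?L by (rule finite_measure_interval)
  have m: "measure ?L (space ?L) = T"
    using T by (simp add: measure_restrict_space space_restrict_space)
  have "(\<integral>s. f s \<partial>?L) < (\<integral>s. c \<partial>?L)"
  proof (rule integral_less_AE_space[OF f])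
    have "AE s in lborel. s \<in> {0..T} \<longrightarrow> f s < c"
      using AE_lborel_singleton[of T] by eventually_elim (auto intro: less)
    then show "AE s in ?L. f s < c" by (simp add: AE_restrict_space_iff)
    show "emeasure ?L (space ?L) \<noteq> 0"
      using T by (simp add: space_restrict_space emeasure_restrict_space)
  qed simp
  then show ?thesis using T m by (simp add: field_simps)
qed

lemma integral_greater_interval:
  fixes f :: "real \<Rightarrow> real"
  assumes T: "0 < T" and f: "integrable (restrict_space lborel {0..T}) f"
    and less: "\<And>s. 0 \<le> s \<Longrightarrow> s < T \<Longrightarrow> c < f s"
  shows "c < 1 / T * (\<integral>s. f s \<partial>restrict_space lborel {0..T})"
  using integral_less_interval[OF T, of "\<lambda>s. - f s" "- c"] f less by simp

context markov_additive_process
begin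

lemma price_occupation_integrable:
  assumes int: "\<And>t. 0 \<le> t \<Longrightarrow> integrable (P \<alpha> x) (\<lambda>\<omega>. exp (\<xi> t \<omega>))"
    and C: "\<And>t. 0 \<le> t \<Longrightarrow> t < T \<Longrightarrow> (\<integral>\<omega>. exp (\<xi> t \<omega>) \<partial>P \<alpha> x) \<le> C"
  shows "integrable (occupation_space T \<alpha> x) (\<lambda>p. exp (\<xi> (fst p) (snd p)))"
proof (rule integrableI_bounded)
  have m: "(\<lambda>z. exp z) \<in> borel_measurable (borel :: real measure)" "(\<lambda>z::real. ennreal (exp z)) \<in> borel_measurable borel"
    by measurable
  show "(\<lambda>p. exp (\<xi> (fst p) (snd p))) \<in> borel_measurable (occupation_space T \<alpha> x)"
    by (rule measurable_occupation[where w="\<lambda>_ z. exp z", OF m(1)])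
  have "(\<integral>\<^sup>+p. ennreal (norm (exp (\<xi> (fst p) (snd p)))) \<partial>occupation_space T \<alpha> x) = potential T (\<lambda>_ z. ennreal (exp z)) \<alpha> x"
    using nn_integral_occupation(1)[where w="\<lambda>_ z. ennreal (exp z)", OF m(2), of T \<alpha> x] by simp
  also have "\<dots> \<le> (\<integral>\<^sup>+u. ennreal C * indicator {0..<T} u \<partial>lborel)"
    unfolding potential_def
  proof (rule nn_integral_mono)
    fix u
    show "(\<integral>\<^sup>+\<omega>. ennreal (exp (Xp u \<omega>)) \<partial>P \<alpha> x) * indicator {0..<T} u \<le> ennreal C * indicator {0..<T} u"
    proof (cases "u \<in> {0..<T}")
      case True
      then have "(\<integral>\<^sup>+\<omega>. ennreal (exp (\<xi> u \<omega>)) \<partial>P \<alpha> x) = ennreal (\<integral>\<omega>. exp (\<xi> u \<omega>) \<partial>P \<alpha> x)"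
        using int[of u] by (intro nn_integral_eq_integral) auto
      also have "\<dots> \<le> ennreal C" using C[of u] True by (intro ennreal_leI) auto
      finally show ?thesis using True by simp
    qed simp
  qed
  also have "\<dots> < \<infinity>"
    by (cases "0 \<le> T") (simp_all add: nn_integral_cmult_indicator ennreal_mult_less_top)
  finally show "(\<integral>\<^sup>+p. ennreal (norm (exp (\<xi> (fst p) (snd p)))) \<partial>occupation_space T \<alpha> x) < \<infinity>" .
qed

abbreviation price_integral :: "real \<Rightarrow> 'a \<Rightarrow> real" where
  "price_integral T \<omega> \<equiv> LINT s:{0..T}|lborel. exp (\<xi> s \<omega>)"

lemma price_integral_nonneg: "0 \<le> price_integral T \<omega>"
  unfolding time_integral_eq by (rule Bochner_Integration.integral_nonneg) simp

lemma
  assumes occ: "integrable (occupation_space T \<alpha> x) (\<lambda>p. exp (\<xi> (fst p) (snd p)))"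
  shows integrable_price_integral: "integrable (P \<alpha> x) (price_integral T)"
    and integrable_expected_price: "integrable (restrict_space lborel {0..T}) (\<lambda>t. \<integral>\<omega>. exp (\<xi> t \<omega>) \<partial>P \<alpha> x)"
    and expected_price_integral: "(\<integral>\<omega>. price_integral T \<omega> \<partial>P \<alpha> x)
      = (\<integral>t. (\<integral>\<omega>. exp (\<xi> t \<omega>) \<partial>P \<alpha> x) \<partial>restrict_space lborel {0..T})"
proof -
  interpret pair_sigma_finite "restrict_space lborel {0..T}" "P \<alpha> x" by (rule pair_sigma_finite_occupation)
  have i: "integrable (occupation_space T \<alpha> x) (case_prod (\<lambda>t \<omega>. exp (\<xi> t \<omega>)))"
    using occ by (simp add: case_prod_unfold)
  show "integrable (P \<alpha> x) (price_integral T)"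
    using integrable_snd[OF i] by (simp add: time_integral_eq)
  show "integrable (restrict_space lborel {0..T}) (\<lambda>t. \<integral>\<omega>. exp (\<xi> t \<omega>) \<partial>P \<alpha> x)"
    using integrable_fst[OF i] .
  show "(\<integral>\<omega>. price_integral T \<omega> \<partial>P \<alpha> x)
      = (\<integral>t. (\<integral>\<omega>. exp (\<xi> t \<omega>) \<partial>P \<alpha> x) \<partial>restrict_space lborel {0..T})"
    using integral_snd[OF i] integral_fst[OF i] by (simp add: time_integral_eq)
qed

lemma
  assumes T: "0 < T" and occ: "integrable (occupation_space T \<alpha> x) (\<lambda>p. exp (\<xi> (fst p) (snd p)))"
  shows integrable_expected_payoff:
      "integrable (restrict_space lborel {0..T}) (\<lambda>t. \<integral>\<omega>. call_payoff k (exp (\<xi> t \<omega>)) \<partial>P \<alpha> x)"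
    and average_payoff_le: "(\<integral>\<omega>. call_payoff k (1 / T * price_integral T \<omega>) \<partial>P \<alpha> x)
      \<le> 1 / T * (\<integral>t. (\<integral>\<omega>. call_payoff k (exp (\<xi> t \<omega>)) \<partial>P \<alpha> x) \<partial>restrict_space lborel {0..T})"
proof -
  interpret pair_sigma_finite "restrict_space lborel {0..T}" "P \<alpha> x" by (rule pair_sigma_finite_occupation)
  interpret a: prob_space "P \<alpha> x" by (rule prob_space)
  let ?L = "restrict_space lborel {0..T}"
  have i: "integrable (occupation_space T \<alpha> x) (case_prod (\<lambda>t \<omega>. exp (\<xi> t \<omega>)))"
    using occ by (simp add: case_prod_unfold)
  have p: "integrable (occupation_space T \<alpha> x) (case_prod (\<lambda>t \<omega>. call_payoff k (exp (\<xi> t \<omega>))))"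
    using finite_measure.integrable_call_payoff[OF finite_measure_occupation occ] by (simp add: case_prod_unfold)
  show "integrable ?L (\<lambda>t. \<integral>\<omega>. call_payoff k (exp (\<xi> t \<omega>)) \<partial>P \<alpha> x)"
    using integrable_fst[OF p] .
  have "(\<integral>\<omega>. call_payoff k (1 / T * price_integral T \<omega>) \<partial>P \<alpha> x)
    \<le> (\<integral>\<omega>. 1 / T * (\<integral>t. call_payoff k (exp (\<xi> t \<omega>)) \<partial>?L) \<partial>P \<alpha> x)"
  proof (rule integral_mono_AE)
    show "integrable (P \<alpha> x) (\<lambda>\<omega>. call_payoff k (1 / T * price_integral T \<omega>))"
      by (intro a.integrable_call_payoff integrable_mult_right integrable_price_integral[OF occ])
    show "integrable (P \<alpha> x) (\<lambda>\<omega>. 1 / T * (\<integral>t. call_payoff k (exp (\<xi> t \<omega>)) \<partial>?L))"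
      by (intro integrable_mult_right integrable_snd[OF p])
    show "AE \<omega> in P \<alpha> x. call_payoff k (1 / T * price_integral T \<omega>) \<le> 1 / T * (\<integral>t. call_payoff k (exp (\<xi> t \<omega>)) \<partial>?L)"
      using AE_integrable_snd[OF i]
      by eventually_elim (unfold time_integral_eq, rule call_payoff_time_average_le[OF T])
  qed
  also have "\<dots> = 1 / T * (\<integral>t. (\<integral>\<omega>. call_payoff k (exp (\<xi> t \<omega>)) \<partial>P \<alpha> x) \<partial>?L)"
    using integral_snd[OF p] integral_fst[OF p] by simp
  finally show "(\<integral>\<omega>. call_payoff k (1 / T * price_integral T \<omega>) \<partial>P \<alpha> x)
      \<le> 1 / T * (\<integral>t. (\<integral>\<omega>. call_payoff k (exp (\<xi> t \<omega>)) \<partial>P \<alpha> x) \<partial>?L)" .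
qed

text \<open>
Let \<open>?r\<close> be the mean payoff after the remaining time \<open>T - s\<close>, as a function of the state at time \<open>s\<close>. By
Jensen's inequality \<open>?r\<close> dominates the payoff at the mean price, which exceeds the present price. If that
mean is above the strike, \<open>?r\<close> is strictly larger than the present payoff; otherwise the present payoff is
zero. Thus \<open>?r\<close> and the present payoff agree only where both are zero, and integrating over the state at
time \<open>s\<close> gives the alternative.
\<close>

lemma expected_payoff_increasing:
  assumes int: "\<And>\<beta> z t. 0 \<le> t \<Longrightarrow> integrable (P \<beta> z) (\<lambda>\<omega>. exp (\<xi> t \<omega>))"
    and inc: "\<And>\<beta> z t. 0 < t \<Longrightarrow> exp z < (\<integral>\<omega>. exp (\<xi> t \<omega>) \<partial>P \<beta> z)"
    and s: "0 \<le> s" "s < T"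
  shows "(\<integral>\<omega>. call_payoff k (exp (\<xi> s \<omega>)) \<partial>P \<alpha> x) < (\<integral>\<omega>. call_payoff k (exp (\<xi> T \<omega>)) \<partial>P \<alpha> x)
    \<or> (\<integral>\<omega>. call_payoff k (exp (\<xi> T \<omega>)) \<partial>P \<alpha> x) = 0 \<and> (\<integral>\<omega>. call_payoff k (exp (\<xi> s \<omega>)) \<partial>P \<alpha> x) = 0"
proof -
  define w where "w \<beta> z = ennreal (call_payoff k (exp z))" for \<beta> :: 'e and z
  have w: "w \<beta> \<in> borel_measurable borel" for \<beta> unfolding w_def by measurable
  have nn: "(\<integral>\<^sup>+\<omega>. w (J t \<omega>) (\<xi> t \<omega>) \<partial>P \<beta> z) = ennreal (\<integral>\<omega>. call_payoff k (exp (\<xi> t \<omega>)) \<partial>P \<beta> z)"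
    if "0 \<le> t" for t \<beta> z
  proof -
    interpret b: prob_space "P \<beta> z" by (rule prob_space)
    show ?thesis unfolding w_def
      by (intro nn_integral_eq_integral b.integrable_call_payoff int that AE_I2 call_payoff_nonneg)
  qed
  let ?r = "transition (T - s) w"
  have r: "w \<beta> z < ?r \<beta> z \<or> ?r \<beta> z = 0 \<and> w \<beta> z = 0" for \<beta> z
  proof -
    let ?m = "\<integral>\<omega>. exp (\<xi> (T - s) \<omega>) \<partial>P \<beta> z"
    have ts: "0 \<le> T - s" "0 < T - s" using s by auto
    have "ennreal (call_payoff k ?m) \<le> ennreal (\<integral>\<omega>. call_payoff k (exp (\<xi> (T - s) \<omega>)) \<partial>P \<beta> z)"
      by (intro ennreal_leI call_payoff_integral_le prob_space int ts)
    also have "\<dots> = ?r \<beta> z"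
      using nn[OF ts(1), of \<beta> z] nn_integral_state[where w=w, OF ts(1) w, of \<beta> z] by simp
    finally have m: "ennreal (call_payoff k ?m) \<le> ?r \<beta> z" .
    have e: "exp z < ?m" by (rule inc[OF ts(2)])
    show ?thesis
    proof (cases "k < ?m")
      case True
      then have "call_payoff k (exp z) < call_payoff k ?m" using e by (auto simp: call_payoff_def)
      then have "w \<beta> z < ennreal (call_payoff k ?m)"
        unfolding w_def by (simp add: ennreal_less_iff call_payoff_nonneg)
      then show ?thesis using m by (auto intro: less_le_trans)
    next
      case False
      then have "w \<beta> z = 0" using e by (simp add: w_def call_payoff_def)
      then show ?thesis by (cases "?r \<beta> z = 0") (auto simp: zero_less_iff_neq_zero)
    qed
  qed
  have rm: "?r \<beta> \<in> borel_measurable borel" for \<beta>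
    using measurable_compose[OF measurable_Pair1' measurable_transition[where w=w and \<beta>=\<beta>, OF w], of "T - s"] s
    by simp
  have T: "0 \<le> T" using s by simp
  have UT: "(\<integral>\<^sup>+\<omega>. ?r (J s \<omega>) (\<xi> s \<omega>) \<partial>P \<alpha> x) = ennreal (\<integral>\<omega>. call_payoff k (exp (\<xi> T \<omega>)) \<partial>P \<alpha> x)"
    using markov[where v="\<lambda>_ _. 1" and w=w, OF s(1) _ _ w, of "T - s" \<alpha> x] s nn[OF T, of \<alpha> x] by simp
  note Us = nn[OF s(1), of \<alpha> x]
  have le: "w \<beta> z \<le> ?r \<beta> z" for \<beta> z using r[of \<beta> z] by auto
  note ms = measurable_path_state[where w=w, OF s(1) w, of \<alpha> x]
    measurable_path_state[where w="?r", OF s(1) rm, of \<alpha> x]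
  have nonneg: "0 \<le> (\<integral>\<omega>. call_payoff k (exp (\<xi> t \<omega>)) \<partial>P \<alpha> x)" for t
    by (intro Bochner_Integration.integral_nonneg call_payoff_nonneg)
  show ?thesis
  proof (cases "AE \<omega> in P \<alpha> x. ?r (J s \<omega>) (\<xi> s \<omega>) \<le> w (J s \<omega>) (\<xi> s \<omega>)")
    case True
    have rz: "?r b y \<le> w b y \<Longrightarrow> ?r b y = 0" for b y using r[of b y] by auto
    have "(\<integral>\<^sup>+\<omega>. ?r (J s \<omega>) (\<xi> s \<omega>) \<partial>P \<alpha> x) = (\<integral>\<^sup>+\<omega>. 0 \<partial>P \<alpha> x)"
      by (rule nn_integral_cong_AE) (use True in \<open>eventually_elim, auto dest: rz\<close>)
    moreover have "(\<integral>\<^sup>+\<omega>. w (J s \<omega>) (\<xi> s \<omega>) \<partial>P \<alpha> x) \<le> (\<integral>\<^sup>+\<omega>. ?r (J s \<omega>) (\<xi> s \<omega>) \<partial>P \<alpha> x)"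
      by (intro nn_integral_mono le)
    ultimately show ?thesis
      using UT Us nonneg[of T] nonneg[of s] by (simp add: ennreal_eq_0_iff)
  next
    case False
    have "(\<integral>\<^sup>+\<omega>. w (J s \<omega>) (\<xi> s \<omega>) \<partial>P \<alpha> x) < (\<integral>\<^sup>+\<omega>. ?r (J s \<omega>) (\<xi> s \<omega>) \<partial>P \<alpha> x)"
      by (rule nn_integral_less[OF ms _ _ False]) (simp_all add: Us le)
    then show ?thesis using UT Us nonneg by (simp add: ennreal_less_iff)
  qed
qed

lemma expected_price_strictly_decreasing:
  assumes int: "\<And>\<beta> z t. 0 \<le> t \<Longrightarrow> integrable (P \<beta> z) (\<lambda>\<omega>. exp (\<xi> t \<omega>))"
    and dec: "\<And>\<beta> z t. 0 < t \<Longrightarrow> (\<integral>\<omega>. exp (\<xi> t \<omega>) \<partial>P \<beta> z) < exp z"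
    and s: "0 \<le> s" "s < T"
  shows "(\<integral>\<omega>. exp (\<xi> T \<omega>) \<partial>P \<alpha> x) < (\<integral>\<omega>. exp (\<xi> s \<omega>) \<partial>P \<alpha> x)"
proof -
  interpret a: prob_space "P \<alpha> x" by (rule prob_space)
  define w where "w \<beta> z = ennreal (exp z)" for \<beta> :: 'e and z
  have w: "w \<beta> \<in> borel_measurable borel" for \<beta> unfolding w_def by measurable
  have nn: "(\<integral>\<^sup>+\<omega>. w (J t \<omega>) (\<xi> t \<omega>) \<partial>P \<beta> z) = ennreal (\<integral>\<omega>. exp (\<xi> t \<omega>) \<partial>P \<beta> z)"
    if "0 \<le> t" for t \<beta> z
    unfolding w_def by (intro nn_integral_eq_integral int that AE_I2) simp
  let ?r = "transition (T - s) w"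
  have ts: "0 \<le> T - s" "0 < T - s" "0 \<le> T" using s by auto
  have r: "?r \<beta> z < w \<beta> z" for \<beta> z
    unfolding nn_integral_state[where w=w, OF ts(1) w, symmetric] nn[OF ts(1)]
    unfolding w_def by (rule ennreal_lessI[OF exp_gt_zero dec[OF ts(2)]])
  have rm: "?r \<beta> \<in> borel_measurable borel" for \<beta>
    using measurable_compose[OF measurable_Pair1' measurable_transition[where w=w and \<beta>=\<beta>, OF w], of "T - s"] s
    by simp
  have UT: "(\<integral>\<^sup>+\<omega>. ?r (J s \<omega>) (\<xi> s \<omega>) \<partial>P \<alpha> x) = ennreal (\<integral>\<omega>. exp (\<xi> T \<omega>) \<partial>P \<alpha> x)"
    using markov[where v="\<lambda>_ _. 1" and w=w, OF s(1) ts(1) _ w, of \<alpha> x] nn[OF ts(3), of \<alpha> x] by simp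
  have "(\<integral>\<^sup>+\<omega>. ?r (J s \<omega>) (\<xi> s \<omega>) \<partial>P \<alpha> x) < (\<integral>\<^sup>+\<omega>. w (J s \<omega>) (\<xi> s \<omega>) \<partial>P \<alpha> x)"
  proof (rule nn_integral_less)
    show "(\<lambda>\<omega>. ?r (J s \<omega>) (\<xi> s \<omega>)) \<in> borel_measurable (P \<alpha> x)"
      by (rule measurable_path_state[where w="?r", OF s(1) rm])
    show "(\<lambda>\<omega>. w (J s \<omega>) (\<xi> s \<omega>)) \<in> borel_measurable (P \<alpha> x)"
      by (rule measurable_path_state[where w=w, OF s(1) w])
    show "\<not> (AE \<omega> in P \<alpha> x. w (J s \<omega>) (\<xi> s \<omega>) \<le> ?r (J s \<omega>) (\<xi> s \<omega>))"
      by (simp add: not_le[THEN iffD2, OF r])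
  qed (simp_all add: UT less_imp_le[OF r])
  then show ?thesis using UT nn[OF s(1), of \<alpha> x] by (simp add: ennreal_less_iff)
qed

text \<open>
If the European price is zero, all earlier mean payoffs vanish too and so does the Asian price. Otherwise
every earlier mean payoff is strictly smaller than the terminal one, and so is their time average. For
\<open>T \<le> 1\<close> the time integral is at most the time average.
\<close>

lemma asian_cheaper:
  assumes g: "price_generator F P J \<xi> g" and pos: "\<And>\<beta>. 0 < g (\<beta>, 1)" and T: "0 < T"
  shows "cheaper (asian_average_call P \<xi> r k \<alpha> y T) (european_call P \<xi> r k \<alpha> y T)"
    and "T \<le> 1 \<Longrightarrow> cheaper (asian_call P \<xi> r k \<alpha> y T) (european_call P \<xi> r k \<alpha> y T)"
proof -
  let ?M = "P \<alpha> (ln y)" and ?L = "restrict_space lborel {0..T}"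
  interpret a: prob_space ?M by (rule prob_space)
  note int = price_generatorD(3)[OF g]
  note inc = expected_price_increasing[OF g pos]
  define U where "U t = (\<integral>\<omega>. call_payoff k (exp (\<xi> t \<omega>)) \<partial>?M)" for t
  let ?avg = "\<integral>\<omega>. call_payoff k (1 / T * price_integral T \<omega>) \<partial>?M"
  let ?int = "\<integral>\<omega>. call_payoff k (price_integral T \<omega>) \<partial>?M"
  have U: "U s < U T \<or> U T = 0 \<and> U s = 0" if "0 \<le> s" "s < T" for s
    unfolding U_def by (rule expected_payoff_increasing[OF int inc that])
  have "(\<integral>\<omega>. exp (\<xi> t \<omega>) \<partial>?M) \<le> (\<integral>\<omega>. exp (\<xi> T \<omega>) \<partial>?M)" if t: "0 \<le> t" "t < T" for t
  proof -
    have "(\<integral>\<omega>. call_payoff 0 (exp (\<xi> t \<omega>)) \<partial>?M) \<le> (\<integral>\<omega>. call_payoff 0 (exp (\<xi> T \<omega>)) \<partial>?M)"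
      \<comment> \<open>At strike \<open>0\<close> the payoff is the price itself.\<close>
      using expected_payoff_increasing[OF int inc t, where k=0 and \<alpha>=\<alpha> and x="ln y"] by auto
    then show ?thesis by (simp add: call_payoff_def)
  qed
  then have occ: "integrable (occupation_space T \<alpha> (ln y)) (\<lambda>p. exp (\<xi> (fst p) (snd p)))"
    by (intro price_occupation_integrable[OF int]) auto
  have iU: "integrable ?L U" unfolding U_def by (rule integrable_expected_payoff[OF T occ])
  have avg_le: "?avg \<le> 1 / T * (\<integral>s. U s \<partial>?L)" unfolding U_def by (rule average_payoff_le[OF T occ])
  have nonneg: "0 \<le> ?avg" "0 \<le> ?int" by (auto intro!: Bochner_Integration.integral_nonneg call_payoff_nonneg)
  have avg: "?avg < U T \<or> ?avg = 0 \<and> U T = 0"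
  proof (cases "U T = 0")
    case True
    have "U s = 0" if "s \<in> {0..T}" for s using U[of s] True that nonneg
      by (cases "s = T") (auto simp: U_def intro!: antisym[OF _ Bochner_Integration.integral_nonneg] call_payoff_nonneg)
    then have "(\<integral>s. U s \<partial>?L) = (\<integral>s. 0 \<partial>?L)"
      by (intro Bochner_Integration.integral_cong) (auto simp: space_restrict_space)
    then show ?thesis using avg_le nonneg True by simp
  next
    case False
    have "1 / T * (\<integral>s. U s \<partial>?L) < U T"
      by (rule integral_less_interval[OF T iU]) (use U False in blast)
    then show ?thesis using avg_le by simp
  qed
  then show "cheaper (asian_average_call P \<xi> r k \<alpha> y T) (european_call P \<xi> r k \<alpha> y T)"
    by (auto simp: cheaper_def asian_average_call_def european_call_def U_def)
  assume T1: "T \<le> 1"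
  have "?int \<le> ?avg"
  proof (rule Bochner_Integration.integral_mono)
    show "integrable ?M (\<lambda>\<omega>. call_payoff k (price_integral T \<omega>))"
      by (intro a.integrable_call_payoff integrable_price_integral[OF occ])
    show "integrable ?M (\<lambda>\<omega>. call_payoff k (1 / T * price_integral T \<omega>))"
      by (intro a.integrable_call_payoff integrable_mult_right integrable_price_integral[OF occ])
    show "call_payoff k (price_integral T \<omega>) \<le> call_payoff k (1 / T * price_integral T \<omega>)" for \<omega>
      using mult_right_mono[OF _ price_integral_nonneg, of 1 "1 / T" T \<omega>] T T1
      by (intro call_payoff_mono) simp
  qed
  then have "?int < U T \<or> ?int = 0 \<and> U T = 0" using avg nonneg by linarith
  then show "cheaper (asian_call P \<xi> r k \<alpha> y T) (european_call P \<xi> r k \<alpha> y T)"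
    by (auto simp: cheaper_def asian_call_def european_call_def U_def)
qed

text \<open>
Half of the gap between the mean of the average price and the mean terminal price serves as the
threshold for the strike: a positive strike lowers the Asian price by at most its own amount and does not
raise the European one.
\<close>

lemma european_cheaper:
  assumes g: "price_generator F P J \<xi> g" and neg: "\<And>\<beta>. g (\<beta>, 1) < 0" and T: "0 < T"
  shows "\<exists>K>0. \<forall>k\<le>K.
           european_call P \<xi> r k \<alpha> y T < asian_average_call P \<xi> r k \<alpha> y T \<and>
           (T \<ge> 1 \<longrightarrow> european_call P \<xi> r k \<alpha> y T < asian_call P \<xi> r k \<alpha> y T)"
proof -
  let ?M = "P \<alpha> (ln y)" and ?L = "restrict_space lborel {0..T}"
  interpret a: prob_space ?M by (rule prob_space)
  note int = price_generatorD(3)[OF g]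
  note dec = expected_price_decreasing[OF g neg]
  have T0: "0 \<le> T" using T by simp
  define S where "S t = (\<integral>\<omega>. exp (\<xi> t \<omega>) \<partial>?M)" for t
  let ?A = "\<lambda>\<omega>. 1 / T * price_integral T \<omega>"
  have ST: "S T < S t" if "0 \<le> t" "t < T" for t T
    unfolding S_def by (rule expected_price_strictly_decreasing[OF int dec that])
  have S0: "S t \<le> S 0" if t: "0 \<le> t" for t
    using ST[of 0 t] t by (cases "t = 0") auto
  have occ: "integrable (occupation_space T \<alpha> (ln y)) (\<lambda>p. exp (\<xi> (fst p) (snd p)))"
    using S0 unfolding S_def by (intro price_occupation_integrable[OF int]) auto
  have iA: "integrable ?M ?A" by (intro integrable_mult_right integrable_price_integral[OF occ])
  have iS: "integrable ?L S" unfolding S_def by (rule integrable_expected_price[OF occ])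
  have "S T < 1 / T * (\<integral>t. S t \<partial>?L)"
    by (rule integral_greater_interval[OF T iS ST])
  also have "\<dots> = (\<integral>\<omega>. ?A \<omega> \<partial>?M)"
    unfolding S_def expected_price_integral[OF occ, symmetric] by simp
  finally have gap: "S T < (\<integral>\<omega>. ?A \<omega> \<partial>?M)" .
  define K where "K = ((\<integral>\<omega>. ?A \<omega> \<partial>?M) - S T) / 2"
  have K: "0 < K" using gap by (simp add: K_def)
  have less: "(\<integral>\<omega>. call_payoff k (exp (\<xi> T \<omega>)) \<partial>?M) < (\<integral>\<omega>. call_payoff k (?A \<omega>) \<partial>?M)" if k: "k \<le> K" for k
  proof -
    \<comment> \<open>For \<open>k \<le> 0\<close> this is the exact payoff, for \<open>k > 0\<close> the payoff at strike \<open>0\<close>.\<close>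
    have "(\<integral>\<omega>. call_payoff k (exp (\<xi> T \<omega>)) \<partial>?M) \<le> (\<integral>\<omega>. exp (\<xi> T \<omega>) - min k 0 \<partial>?M)"
      by (intro Bochner_Integration.integral_mono a.integrable_call_payoff int[OF T0] Bochner_Integration.integrable_diff a.integrable_const)
        (auto simp: call_payoff_def min_def intro: order_trans[OF _ less_imp_le[OF exp_gt_zero]])
    also have "\<dots> = S T - min k 0" using int[OF T0, of \<alpha> "ln y"] by (simp add: S_def a.prob_space)
    also have "\<dots> < (\<integral>\<omega>. ?A \<omega> \<partial>?M) - k"
      using k K gap by (auto simp: K_def min_def field_simps)
    also have "\<dots> = (\<integral>\<omega>. ?A \<omega> - k \<partial>?M)" using iA by (simp add: a.prob_space)
    also have "\<dots> \<le> (\<integral>\<omega>. call_payoff k (?A \<omega>) \<partial>?M)"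
      using iA by (intro Bochner_Integration.integral_mono a.integrable_call_payoff Bochner_Integration.integrable_diff a.integrable_const)
        (auto simp: call_payoff_def)
    finally show ?thesis .
  qed
  have le: "(\<integral>\<omega>. call_payoff k (?A \<omega>) \<partial>?M) \<le> (\<integral>\<omega>. call_payoff k (price_integral T \<omega>) \<partial>?M)" if T1: "1 \<le> T" for k
  proof (rule Bochner_Integration.integral_mono)
    show "integrable ?M (\<lambda>\<omega>. call_payoff k (price_integral T \<omega>))"
      by (intro a.integrable_call_payoff integrable_price_integral[OF occ])
    show "integrable ?M (\<lambda>\<omega>. call_payoff k (?A \<omega>))"
      by (intro a.integrable_call_payoff iA)
    show "call_payoff k (?A \<omega>) \<le> call_payoff k (price_integral T \<omega>)" for \<omega>
      using mult_right_mono[OF _ price_integral_nonneg, of "1 / T" 1 T \<omega>] T T1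
      by (intro call_payoff_mono) simp
  qed
  show ?thesis
  proof (intro exI[of _ K] conjI allI impI K)
    fix k assume k: "k \<le> K"
    show "european_call P \<xi> r k \<alpha> y T < asian_average_call P \<xi> r k \<alpha> y T"
      using less[OF k] by (simp add: european_call_def asian_average_call_def)
    assume "1 \<le> T"
    then show "european_call P \<xi> r k \<alpha> y T < asian_call P \<xi> r k \<alpha> y T"
      using less_le_trans[OF less[OF k] le] by (simp add: european_call_def asian_call_def)
  qed
qed

end

theorem theorem4p4:
  fixes \<Omega> :: "'a set"
    and F :: "real \<Rightarrow> 'a measure"
    and P :: "'e::finite \<Rightarrow> real \<Rightarrow> 'a measure"
    and J :: "real \<Rightarrow> 'a \<Rightarrow> 'e"
    and \<xi> :: "real \<Rightarrow> 'a \<Rightarrow> real"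
    and r :: real
    and Af :: "'e \<times> real \<Rightarrow> real"
  assumes "markov_additive_process \<Omega> F P J \<xi>"
    and "irreducible_modulator P J"
    and "ergodic_modulator P J"
    and "price_generator F P J \<xi> Af"
  shows "((\<forall>\<alpha>. Af (\<alpha>, 1) > 0) \<longrightarrow>
           (\<forall>\<alpha> y T k. y > 0 \<longrightarrow> T > 0 \<longrightarrow>
              cheaper (asian_average_call P \<xi> r k \<alpha> y T) (european_call P \<xi> r k \<alpha> y T) \<and>
              (T \<le> 1 \<longrightarrow> cheaper (asian_call P \<xi> r k \<alpha> y T) (european_call P \<xi> r k \<alpha> y T)))) \<and>
         ((\<forall>\<alpha>. Af (\<alpha>, 1) < 0) \<longrightarrow>
           (\<forall>\<alpha> y T. y > 0 \<longrightarrow> T > 0 \<longrightarrow>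
              (\<exists>K>0. \<forall>k\<le>K.
                 european_call P \<xi> r k \<alpha> y T < asian_average_call P \<xi> r k \<alpha> y T \<and>
                 (T \<ge> 1 \<longrightarrow> european_call P \<xi> r k \<alpha> y T < asian_call P \<xi> r k \<alpha> y T))))"
proof -
  interpret markov_additive_process \<Omega> F P J \<xi> by fact
  show ?thesis
    using asian_cheaper[OF assms(4)] european_cheaper[OF assms(4)] by blast
qed

end
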